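(* Let $n\ge1$. The system of functions $$\Psi^{(0)}_{e;ja}(x)=2^{-nj/2}\chi_2\big(2^{-1}k_e\cdot(2^jx-a)\big)\,\Omega\big(|2^jx-a|_2\big),\qquad x\in\mathbb{Q}_2^n,$$ indexed by $e\subset\{1,\dots,n\}$ with $e\ne\emptyset$, $j\in\mathbb{Z}$, and $a\in I_2^n$, is an orthonormal basis of $\mathcal{L}^2(\mathbb{Q}_2^n)$.
   Context: $\mathbb{Q}_2$ is the field of $2$-adic numbers; on $\mathbb{Q}_2^n$ use the norm $|x|_2=\max_\nu|x_\nu|_2$ and the product Haar measure normalized so that $\mathbb{Z}_2^n$ has measure $1$. $\mathcal{L}^2(\mathbb{Q}_2^n)$ is the space of complex-valued square-integrable functions. $\chi_2(t)=e^{2\pi i\{t\}_2}$ for $t\in\mathbb{Q}_2$, where $\{t\}_2$ is the $2$-adic fractional part; $\xi\cdot x=\sum_\nu\xi_\nu x_\nu$. $\Omega(t)=1$ for $0\le t\le1$ and $\Omega(t)=0$ for $t>1$. $I_2=\{2^{-\gamma}(a_0+a_12+\cdots+a_{\gamma-1}2^{\gamma-1}):\gamma\in\mathbb{N},\ a_j\in\{0,1\}\}\subset\mathbb{Q}_2$ (representatives of $\mathbb{Q}_2/\mathbb{Z}_2$), and $I_2^n=I_2\times\cdots\times I_2$. For $e\subset\{1,\dots,n\}$, $k_e\in\{0,1\}^n$ is the vector with $(k_e)_\nu=1$ if $\nu\in e$ and $(k_e)_\nu=0$ if $\nu\notin e$. *)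

theory Defs
  imports "HOL-Probability.Probability"
begin

text \<open>\<open>\<rat>\<^sub>2\<close> is constructed as the completion of \<open>\<rat>\<close> (Cauchy sequences modulo null sequences) for the
  2-adic absolute value \<open>\<bar>2\<^sup>v p / q\<bar>\<^sub>2 = 2\<^sup>-\<^sup>v\<close> with \<open>p\<close>, \<open>q\<close> odd.\<close>

definition rat_abs2 :: "rat \<Rightarrow> real" where
  "rat_abs2 r = (if r = 0 then 0 else
     2 powi (int (multiplicity 2 (snd (quotient_of r))) - int (multiplicity 2 (fst (quotient_of r)))))"

lemma rat_abs2_divide:
  fixes a b :: int
  assumes "a \<noteq> 0" "b \<noteq> 0"
  shows "rat_abs2 (of_int a / of_int b) = 2 powi (int (multiplicity 2 b) - int (multiplicity 2 a))"
proof -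
  obtain p q where pq: "quotient_of (of_int a / of_int b) = (p, q)" by (cases "quotient_of (of_int a / of_int b)")
  have q: "q > 0" using quotient_of_denom_pos[OF pq] .
  have eq: "(of_int a / of_int b :: rat) = of_int p / of_int q" by (rule quotient_of_div[OF pq])
  then have "of_int (a * q) = (of_int (p * b) :: rat)" using q assms by (simp add: field_simps)
  then have 1: "a * q = p * b" by (simp only: of_int_eq_iff)
  have p: "p \<noteq> 0" using 1 assms q by auto
  have "multiplicity 2 (a * q) = multiplicity 2 a + multiplicity 2 q"
    using assms q by (intro prime_elem_multiplicity_mult_distrib) auto
  moreover have "multiplicity 2 (p * b) = multiplicity 2 p + multiplicity 2 b"
    using assms p by (intro prime_elem_multiplicity_mult_distrib) auto
  ultimately have "multiplicity 2 a + multiplicity 2 q = multiplicity 2 p + multiplicity 2 b" using 1 by simp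
  then have "int (multiplicity 2 q) - int (multiplicity 2 p) = int (multiplicity 2 b) - int (multiplicity 2 a)" by linarith
  then show ?thesis using assms by (simp add: rat_abs2_def pq)
qed

lemma rat_cases_frac:
  fixes r :: rat
  obtains a b :: int where "r = of_int a / of_int b" "b > 0"
proof -
  obtain p q where "quotient_of r = (p, q)" by (cases "quotient_of r")
  with quotient_of_denom_pos[OF this] quotient_of_div[OF this] show ?thesis using that by blast
qed

lemma rat_abs2_0 [simp]: "rat_abs2 0 = 0" by (simp add: rat_abs2_def)
lemma rat_abs2_nonneg [simp]: "rat_abs2 r \<ge> 0" by (simp add: rat_abs2_def)
lemma rat_abs2_eq_0 [simp]: "rat_abs2 r = 0 \<longleftrightarrow> r = 0" by (simp add: rat_abs2_def)
lemma rat_abs2_of_int: "a \<noteq> 0 \<Longrightarrow> rat_abs2 (of_int a) = 2 powi (- int (multiplicity 2 a))"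
  using rat_abs2_divide[of a 1] by simp

lemma rat_abs2_1 [simp]: "rat_abs2 1 = 1" using rat_abs2_of_int[of 1] by simp

lemma rat_abs2_mult: "rat_abs2 (x * y) = rat_abs2 x * rat_abs2 y"
proof (cases "x = 0 \<or> y = 0")
  case False
  obtain a b :: int where x: "x = of_int a / of_int b" "b > 0" by (rule rat_cases_frac)
  obtain c d :: int where y: "y = of_int c / of_int d" "d > 0" by (rule rat_cases_frac)
  have nz: "a \<noteq> 0" "c \<noteq> 0" "b \<noteq> 0" "d \<noteq> 0" using False x y by auto
  have "rat_abs2 (x * y) = rat_abs2 (of_int (a * c) / of_int (b * d))" by (simp add: x y)
  also have "\<dots> = 2 powi (int (multiplicity 2 (b * d)) - int (multiplicity 2 (a * c)))"
    using nz by (intro rat_abs2_divide) auto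
  also have "\<dots> = 2 powi ((int (multiplicity 2 b) - int (multiplicity 2 a)) + (int (multiplicity 2 d) - int (multiplicity 2 c)))"
    using nz by (simp add: prime_elem_multiplicity_mult_distrib algebra_simps)
  also have "\<dots> = rat_abs2 x * rat_abs2 y"
    using nz by (subst power_int_add) (auto simp: x y rat_abs2_divide)
  finally show ?thesis .
qed auto

lemma rat_abs2_minus [simp]: "rat_abs2 (- x) = rat_abs2 x"
proof -
  have "multiplicity 2 (-1 :: int) = 0" by (rule not_dvd_imp_multiplicity_0) simp
  then have "rat_abs2 (-1) = 1" using rat_abs2_of_int[of "-1"] by simp
  then show ?thesis using rat_abs2_mult[of "-1" x] by simp
qed

lemma rat_abs2_minus_commute: "rat_abs2 (x - y) = rat_abs2 (y - x)"
  using rat_abs2_minus[of "x - y"] by simp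

lemma rat_abs2_inverse: "rat_abs2 (inverse x) = inverse (rat_abs2 x)"
proof (cases "x = 0")
  case False
  have "rat_abs2 (inverse x) * rat_abs2 x = 1" using False by (simp flip: rat_abs2_mult)
  then have "rat_abs2 x * rat_abs2 (inverse x) = 1" by (simp only: mult.commute)
  then show ?thesis by (rule inverse_unique[symmetric])
qed auto

lemma rat_abs2_of_int_le1: "rat_abs2 (of_int a) \<le> 1"
  by (cases "a = 0") (auto simp: rat_abs2_of_int power_int_minus inverse_le_1_iff)

lemma rat_abs2_of_int_le_iff: "rat_abs2 (of_int a) \<le> 2 powi (- int k) \<longleftrightarrow> 2 ^ k dvd a"
proof (cases "a = 0")
  case False
  then have "2 ^ k dvd a \<longleftrightarrow> k \<le> multiplicity 2 a"
    by (intro power_dvd_iff_le_multiplicity) auto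
  then show ?thesis using False by (simp add: rat_abs2_of_int power_int_minus)
qed auto

lemma rat_abs2_2: "rat_abs2 2 = 1 / 2"
  using rat_abs2_of_int[of 2] by (simp add: power_int_minus)

lemma rat_abs2_add: "rat_abs2 (x + y) \<le> max (rat_abs2 x) (rat_abs2 y)"
proof -
  have *: "rat_abs2 (1 + z) \<le> 1" if z: "rat_abs2 z \<le> 1" for z
  proof (cases "z = 0 \<or> 1 + z = 0")
    case False
    obtain p q where pq: "quotient_of z = (p, q)" by (cases "quotient_of z")
    have q: "q > 0" using quotient_of_denom_pos[OF pq] .
    have eq: "z = of_int p / of_int q" by (rule quotient_of_div[OF pq])
    have p: "p \<noteq> 0" using False eq by auto
    have le: "multiplicity 2 q \<le> multiplicity 2 p"
    proof (rule ccontr)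
      assume "\<not> ?thesis"
      then have "(1::real) < 2 powi (int (multiplicity 2 q) - int (multiplicity 2 p))"
        by (intro one_less_power_int) auto
      also have "\<dots> = rat_abs2 z" unfolding eq using p q by (subst rat_abs2_divide) auto
      finally show False using z by simp
    qed
    have pq0: "p + q \<noteq> 0"
    proof
      assume "p + q = 0"
      then have "p = - q" by simp
      with eq q False show False by simp
    qed
    have "2 ^ multiplicity 2 q dvd p + q"
      using le by (intro dvd_add multiplicity_dvd' multiplicity_dvd) auto
    then have le': "multiplicity 2 q \<le> multiplicity 2 (p + q)"
      using pq0 by (intro multiplicity_geI) auto
    have "1 + z = of_int (p + q) / of_int q" using q by (simp add: eq field_simps)
    then have "rat_abs2 (1 + z) = 2 powi (int (multiplicity 2 q) - int (multiplicity 2 (p + q)))"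
      using rat_abs2_divide[OF pq0, of q] q by simp
    also have "\<dots> \<le> 2 powi 0"
      using le' by (intro power_int_increasing) auto
    finally show ?thesis by simp
  qed auto
  have main: "rat_abs2 (x + y) \<le> rat_abs2 x" if "rat_abs2 y \<le> rat_abs2 x" "x \<noteq> 0" for x y
  proof -
    have "x + y = x * (1 + y / x)" using that by (simp add: field_simps)
    then have "rat_abs2 (x + y) = rat_abs2 x * rat_abs2 (1 + y / x)" by (simp only: rat_abs2_mult)
    moreover have "rat_abs2 (y / x) = rat_abs2 y / rat_abs2 x"
      by (simp only: divide_inverse rat_abs2_mult rat_abs2_inverse)
    then have "rat_abs2 (y / x) \<le> 1" using that by (simp add: divide_le_eq_1 less_le)
    then have "rat_abs2 x * rat_abs2 (1 + y / x) \<le> rat_abs2 x * 1"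
      by (intro mult_left_mono *) auto
    ultimately have "rat_abs2 (x + y) \<le> rat_abs2 x * 1" by simp
    then show ?thesis by simp
  qed
  show ?thesis
  proof (cases "x = 0 \<or> y = 0")
    case True then show ?thesis by auto
  next
    case False
    then show ?thesis using main[of y x] main[of x y] by (cases "rat_abs2 y \<le> rat_abs2 x") (auto simp: add.commute)
  qed
qed

lemma rat_abs2_diff: "rat_abs2 (x - y) \<le> max (rat_abs2 x) (rat_abs2 y)"
  using rat_abs2_add[of x "- y"] by simp

lemma rat_abs2_triangle: "rat_abs2 (x + y) \<le> rat_abs2 x + rat_abs2 y"
  using rat_abs2_add[of x y] rat_abs2_nonneg[of x] rat_abs2_nonneg[of y] by linarith

lemma rat_abs2_abs_diff: "\<bar>rat_abs2 x - rat_abs2 y\<bar> \<le> rat_abs2 (x - y)"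
  using rat_abs2_triangle[of "x - y" y] rat_abs2_triangle[of "y - x" x] rat_abs2_minus_commute[of x y] by simp

definition cauchy2 :: "(nat \<Rightarrow> rat) \<Rightarrow> bool" where
  "cauchy2 X \<longleftrightarrow> (\<forall>\<epsilon>>0. \<exists>N. \<forall>m\<ge>N. \<forall>n\<ge>N. rat_abs2 (X m - X n) < \<epsilon>)"

definition null2 :: "(nat \<Rightarrow> rat) \<Rightarrow> bool" where
  "null2 X \<longleftrightarrow> (\<lambda>n. rat_abs2 (X n)) \<longlonglongrightarrow> 0"

definition rel2 :: "(nat \<Rightarrow> rat) \<Rightarrow> (nat \<Rightarrow> rat) \<Rightarrow> bool" where
  "rel2 X Y \<longleftrightarrow> cauchy2 X \<and> cauchy2 Y \<and> null2 (\<lambda>n. X n - Y n)"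

lemma null2_const [simp]: "null2 (\<lambda>n. c) \<longleftrightarrow> c = 0"
  by (simp add: null2_def LIMSEQ_const_iff)

lemma null2_bound: "null2 X \<Longrightarrow> (\<And>n. rat_abs2 (Y n) \<le> rat_abs2 (X n)) \<Longrightarrow> null2 Y"
  unfolding null2_def by (rule tendsto_sandwich[OF _ _ tendsto_const]) auto

lemma null2_add: "null2 X \<Longrightarrow> null2 Y \<Longrightarrow> null2 (\<lambda>n. X n + Y n)"
  unfolding null2_def
  by (rule tendsto_sandwich[OF _ _ tendsto_const, where h = "\<lambda>n. rat_abs2 (X n) + rat_abs2 (Y n)"])
     (auto intro!: rat_abs2_triangle tendsto_add_zero always_eventually)

lemma null2_minus: "null2 X \<Longrightarrow> null2 (\<lambda>n. - X n)"
  by (simp add: null2_def)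

lemma null2_diff_commute: "null2 (\<lambda>n. X n - Y n) \<longleftrightarrow> null2 (\<lambda>n. Y n - X n)"
  by (simp add: null2_def rat_abs2_minus_commute)

lemma cauchy2_const [simp]: "cauchy2 (\<lambda>n. c)" by (auto simp: cauchy2_def)

lemma cauchy2D: assumes "cauchy2 X" "e > 0"
  obtains N where "\<And>m n. m \<ge> N \<Longrightarrow> n \<ge> N \<Longrightarrow> rat_abs2 (X m - X n) < e"
  using assms unfolding cauchy2_def by blast

lemma cauchy2_add: assumes "cauchy2 X" "cauchy2 Y" shows "cauchy2 (\<lambda>n. X n + Y n)"
  unfolding cauchy2_def
proof safe
  fix e :: real assume "e > 0"
  obtain M where M: "\<And>m n. m \<ge> M \<Longrightarrow> n \<ge> M \<Longrightarrow> rat_abs2 (X m - X n) < e"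
    using cauchy2D[OF assms(1) \<open>e > 0\<close>] by blast
  obtain N where N: "\<And>m n. m \<ge> N \<Longrightarrow> n \<ge> N \<Longrightarrow> rat_abs2 (Y m - Y n) < e"
    using cauchy2D[OF assms(2) \<open>e > 0\<close>] by blast
  have "rat_abs2 (X m + Y m - (X n + Y n)) < e" if "m \<ge> max M N" "n \<ge> max M N" for m n
    using rat_abs2_add[of "X m - X n" "Y m - Y n"] M[of m n] N[of m n] that by (auto simp: algebra_simps)
  then show "\<exists>N. \<forall>m\<ge>N. \<forall>n\<ge>N. rat_abs2 (X m + Y m - (X n + Y n)) < e" by blast
qed

lemma cauchy2_minus: "cauchy2 X \<Longrightarrow> cauchy2 (\<lambda>n. - X n)"
  by (simp add: cauchy2_def rat_abs2_minus_commute)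

lemma cauchy2_abs_convergent: assumes "cauchy2 X" shows "convergent (\<lambda>n. rat_abs2 (X n))"
proof -
  have "Cauchy (\<lambda>n. rat_abs2 (X n))"
    unfolding Cauchy_def dist_real_def
  proof (intro allI impI)
    fix e :: real assume "e > 0"
    from cauchy2D[OF assms this] obtain N where "\<And>m n. m \<ge> N \<Longrightarrow> n \<ge> N \<Longrightarrow> rat_abs2 (X m - X n) < e" by blast
    then show "\<exists>M. \<forall>m\<ge>M. \<forall>n\<ge>M. \<bar>rat_abs2 (X m) - rat_abs2 (X n)\<bar> < e"
      using le_less_trans[OF rat_abs2_abs_diff] by (intro exI[of _ N]) blast
  qed
  then show ?thesis by (simp add: Cauchy_convergent_iff)
qed

lemma cauchy2_bounded: assumes "cauchy2 X" obtains B where "B > 0" "\<And>n. rat_abs2 (X n) < B"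
proof -
  have "Bseq (\<lambda>n. rat_abs2 (X n))" using cauchy2_abs_convergent[OF assms] by (rule convergent_imp_Bseq)
  then obtain K where K: "K > 0" "\<And>n. norm (rat_abs2 (X n)) \<le> K" by (auto elim: BseqE)
  show ?thesis by (rule that[of "K + 1"]) (use K in \<open>auto intro: le_less_trans[OF _ less_add_one]\<close>)
qed

lemma cauchy2_mult: assumes X: "cauchy2 X" and Y: "cauchy2 Y" shows "cauchy2 (\<lambda>n. X n * Y n)"
  unfolding cauchy2_def
proof safe
  fix e :: real assume e: "e > 0"
  obtain A where A: "A > 0" "\<And>n. rat_abs2 (X n) < A" using cauchy2_bounded[OF X] by blast
  obtain B where B: "B > 0" "\<And>n. rat_abs2 (Y n) < B" using cauchy2_bounded[OF Y] by blast
  obtain M where M: "\<And>m n. m \<ge> M \<Longrightarrow> n \<ge> M \<Longrightarrow> rat_abs2 (X m - X n) < e / B"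
    using cauchy2D[OF X divide_pos_pos[OF e B(1)]] by blast
  obtain N where N: "\<And>m n. m \<ge> N \<Longrightarrow> n \<ge> N \<Longrightarrow> rat_abs2 (Y m - Y n) < e / A"
    using cauchy2D[OF Y divide_pos_pos[OF e A(1)]] by blast
  have "rat_abs2 (X m * Y m - X n * Y n) < e" if mn: "m \<ge> max M N" "n \<ge> max M N" for m n
  proof -
    have "X m * Y m - X n * Y n = X m * (Y m - Y n) + (X m - X n) * Y n" by (simp add: algebra_simps)
    then have "rat_abs2 (X m * Y m - X n * Y n) \<le> max (rat_abs2 (X m) * rat_abs2 (Y m - Y n)) (rat_abs2 (X m - X n) * rat_abs2 (Y n))"
      using rat_abs2_add[of "X m * (Y m - Y n)" "(X m - X n) * Y n"] by (simp add: rat_abs2_mult)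
    also have "\<dots> < e"
    proof -
      have "rat_abs2 (X m) * rat_abs2 (Y m - Y n) < A * (e / A)" using N[of m n] A mn
        by (intro mult_strict_mono) auto
      moreover have "rat_abs2 (X m - X n) * rat_abs2 (Y n) < (e / B) * B" using M[of m n] B mn e
        by (intro mult_strict_mono) auto
      ultimately show ?thesis using A B by simp
    qed
    finally show ?thesis .
  qed
  then show "\<exists>N. \<forall>m\<ge>N. \<forall>n\<ge>N. rat_abs2 (X m * Y m - X n * Y n) < e" by blast
qed

lemma null2_mult_cauchy: assumes "null2 X" "cauchy2 Y" shows "null2 (\<lambda>n. X n * Y n)"
proof -
  obtain L where "(\<lambda>n. rat_abs2 (Y n)) \<longlonglongrightarrow> L" using cauchy2_abs_convergent[OF assms(2)] by (auto simp: convergent_def)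
  with assms(1) have "(\<lambda>n. rat_abs2 (X n) * rat_abs2 (Y n)) \<longlonglongrightarrow> 0 * L"
    unfolding null2_def by (rule tendsto_mult)
  then show ?thesis by (simp add: null2_def rat_abs2_mult)
qed

lemma not_null2_bound: assumes "cauchy2 X" "\<not> null2 X"
  obtains b N where "b > 0" "\<And>n. n \<ge> N \<Longrightarrow> rat_abs2 (X n) > b"
proof -
  obtain L where L: "(\<lambda>n. rat_abs2 (X n)) \<longlonglongrightarrow> L" using cauchy2_abs_convergent[OF assms(1)] by (auto simp: convergent_def)
  have "L \<ge> 0" using L by (rule LIMSEQ_le_const) auto
  moreover have "L \<noteq> 0" using L assms(2) by (auto simp: null2_def)
  ultimately have "L / 2 > 0" "L > L / 2" by auto
  with order_tendstoD(1)[OF L, of "L/2"] obtain N where "\<And>n. n \<ge> N \<Longrightarrow> rat_abs2 (X n) > L / 2"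
    by (auto simp: eventually_sequentially)
  then show ?thesis using \<open>L / 2 > 0\<close> that by blast
qed

lemma rat_abs2_inverse_diff: assumes "x \<noteq> 0" "y \<noteq> 0"
  shows "rat_abs2 (inverse x - inverse y) = rat_abs2 (x - y) * (inverse (rat_abs2 x) * inverse (rat_abs2 y))"
proof -
  have "inverse x - inverse y = (y - x) * (inverse x * inverse y)" using assms by (simp add: field_simps)
  then show ?thesis by (simp add: rat_abs2_mult rat_abs2_inverse rat_abs2_minus_commute)
qed

lemma cauchy2_inverse: assumes X: "cauchy2 X" and nn: "\<not> null2 X" shows "cauchy2 (\<lambda>n. inverse (X n))"
  unfolding cauchy2_def
proof safe
  fix e :: real assume e: "e > 0"
  obtain b N where b: "b > 0" "\<And>n. n \<ge> N \<Longrightarrow> rat_abs2 (X n) > b" using not_null2_bound[OF X nn] by blast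
  obtain M where M: "\<And>m n. m \<ge> M \<Longrightarrow> n \<ge> M \<Longrightarrow> rat_abs2 (X m - X n) < e * (b * b)"
    using cauchy2D[OF X mult_pos_pos[OF e mult_pos_pos[OF b(1) b(1)]]] by blast
  have "rat_abs2 (inverse (X m) - inverse (X n)) < e" if mn: "m \<ge> max M N" "n \<ge> max M N" for m n
  proof -
    have bd: "rat_abs2 (X m) > b" "rat_abs2 (X n) > b" using b mn by auto
    then have nz: "X m \<noteq> 0" "X n \<noteq> 0" using b by (auto dest: less_trans)
    have "inverse (rat_abs2 (X m)) * inverse (rat_abs2 (X n)) \<le> inverse b * inverse b"
      using bd b by (intro mult_mono) (auto simp: le_imp_inverse_le)
    then have "rat_abs2 (inverse (X m) - inverse (X n)) \<le> rat_abs2 (X m - X n) * (inverse b * inverse b)"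
      unfolding rat_abs2_inverse_diff[OF nz] by (intro mult_left_mono) auto
    also have "\<dots> < e * (b * b) * (inverse b * inverse b)"
      using M[of m n] mn b by (intro mult_strict_right_mono) auto
    also have "\<dots> = e" using b by (simp add: field_simps)
    finally show ?thesis .
  qed
  then show "\<exists>N. \<forall>m\<ge>N. \<forall>n\<ge>N. rat_abs2 (inverse (X m) - inverse (X n)) < e" by blast
qed

lemma rel2_refl [simp]: "rel2 X X \<longleftrightarrow> cauchy2 X" by (simp add: rel2_def)

lemma rel2_null: assumes "rel2 X Y" "null2 X" shows "null2 Y"
proof -
  have "null2 (\<lambda>n. Y n - X n)" using assms null2_diff_commute[of X Y] by (simp add: rel2_def)
  from null2_add[OF this assms(2)] show ?thesis by simp
qed

lemma rel2_sym: "rel2 X Y \<Longrightarrow> rel2 Y X"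
  using null2_diff_commute[of X Y] by (simp add: rel2_def)

lemma rel2_trans: "rel2 X Y \<Longrightarrow> rel2 Y Z \<Longrightarrow> rel2 X Z"
  unfolding rel2_def using null2_add[of "\<lambda>n. X n - Y n" "\<lambda>n. Y n - Z n"] by simp

lemma part_equivp_rel2: "part_equivp rel2"
proof (rule part_equivpI)
  show "\<exists>X. rel2 X X" by (rule exI[of _ "\<lambda>n. 0"]) simp
  show "symp rel2" by (rule sympI) (rule rel2_sym)
  show "transp rel2" by (rule transpI) (rule rel2_trans)
qed

quotient_type Q2 = "nat \<Rightarrow> rat" / partial: rel2
  by (rule part_equivp_rel2)

lemma Q2_exhaust: obtains X where "cauchy2 X" "x = abs_Q2 X"
proof (rule that)
  show "cauchy2 (rep_Q2 x)" using Quotient3_rep_reflp[OF Quotient3_Q2, of x] by simp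
  show "x = abs_Q2 (rep_Q2 x)" by (rule Quotient3_abs_rep[OF Quotient3_Q2, symmetric])
qed

lemma Q2_eqI: "cauchy2 X \<Longrightarrow> cauchy2 Y \<Longrightarrow> abs_Q2 X = abs_Q2 Y \<longleftrightarrow> rel2 X Y"
  using Quotient3_rel[OF Quotient3_Q2, of X Y] by auto

instantiation Q2 :: field
begin

lift_definition zero_Q2 :: Q2 is "\<lambda>n. 0" by simp

lift_definition one_Q2 :: Q2 is "\<lambda>n. 1" by simp

lift_definition plus_Q2 :: "Q2 \<Rightarrow> Q2 \<Rightarrow> Q2" is "\<lambda>X Y n. X n + Y n"
  unfolding rel2_def add_diff_add by (intro conjI cauchy2_add null2_add) auto

lift_definition uminus_Q2 :: "Q2 \<Rightarrow> Q2" is "\<lambda>X n. - X n"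
  unfolding rel2_def minus_diff_minus by (intro conjI cauchy2_minus null2_minus) auto

lift_definition times_Q2 :: "Q2 \<Rightarrow> Q2 \<Rightarrow> Q2" is "\<lambda>X Y n. X n * Y n"
proof -
  fix X Y Z W
  assume *: "rel2 X Y" "rel2 Z W"
  have "null2 (\<lambda>n. (X n - Y n) * Z n + (Z n - W n) * Y n)"
    using * by (intro null2_add null2_mult_cauchy) (auto simp: rel2_def)
  moreover have "(\<lambda>n. (X n - Y n) * Z n + (Z n - W n) * Y n) = (\<lambda>n. X n * Z n - Y n * W n)"
    by (simp add: algebra_simps)
  ultimately show "rel2 (\<lambda>n. X n * Z n) (\<lambda>n. Y n * W n)"
    using * by (auto simp: rel2_def intro: cauchy2_mult)
qed

lift_definition inverse_Q2 :: "Q2 \<Rightarrow> Q2"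
  is "\<lambda>X. if null2 X then (\<lambda>n. 0) else (\<lambda>n. inverse (X n))"
proof -
  fix X Y assume *: "rel2 X Y"
  then have eq: "null2 X \<longleftrightarrow> null2 Y" using rel2_null rel2_sym by blast
  show "rel2 (if null2 X then (\<lambda>n. 0) else (\<lambda>n. inverse (X n))) (if null2 Y then (\<lambda>n. 0) else (\<lambda>n. inverse (Y n)))"
  proof (cases "null2 X")
    case True then show ?thesis using eq by simp
  next
    case False
    have c: "cauchy2 X" "cauchy2 Y" and d: "null2 (\<lambda>n. X n - Y n)" using * by (auto simp: rel2_def)
    have cX: "cauchy2 (\<lambda>n. inverse (X n))" and cY: "cauchy2 (\<lambda>n. inverse (Y n))"
      using False eq c by (auto intro: cauchy2_inverse)
    obtain b N where b: "b > 0" "\<And>n. n \<ge> N \<Longrightarrow> rat_abs2 (X n) > b" using not_null2_bound[OF c(1) False] by blast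
    obtain b' N' where b': "b' > 0" "\<And>n. n \<ge> N' \<Longrightarrow> rat_abs2 (Y n) > b'" using not_null2_bound[OF c(2)] False eq by blast
    have n1: "null2 (\<lambda>n. (X n - Y n) * (inverse (X n) * inverse (Y n)))"
      by (intro null2_mult_cauchy cauchy2_mult cX cY d)
    have "eventually (\<lambda>n. rat_abs2 ((X n - Y n) * (inverse (X n) * inverse (Y n))) = rat_abs2 (inverse (X n) - inverse (Y n))) sequentially"
      unfolding eventually_sequentially
    proof (intro exI allI impI)
      fix n assume "n \<ge> max N N'"
      then have "rat_abs2 (X n) > 0" "rat_abs2 (Y n) > 0" using b(2)[of n] b'(2)[of n] b(1) b'(1) by auto
      then have nz: "X n \<noteq> 0" "Y n \<noteq> 0" by auto
      show "rat_abs2 ((X n - Y n) * (inverse (X n) * inverse (Y n))) = rat_abs2 (inverse (X n) - inverse (Y n))"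
        by (simp add: rat_abs2_inverse_diff[OF nz] rat_abs2_mult rat_abs2_inverse)
    qed
    then have "null2 (\<lambda>n. inverse (X n) - inverse (Y n))"
      using n1 unfolding null2_def by (rule Lim_transform_eventually[rotated])
    then show ?thesis using False eq cX cY by (simp add: rel2_def)
  qed
qed

definition "x - y = x + (- y)" for x y :: Q2

definition "x div y = x * inverse y" for x y :: Q2

instance
proof
  fix a b c :: Q2
  show "a + b = b + a" by transfer (simp add: add.commute rel2_def cauchy2_add)
  show "a + b + c = a + (b + c)" by transfer (simp add: add.assoc rel2_def cauchy2_add)
  show "0 + a = a" by transfer simp
  show "- a + a = 0" by transfer (simp add: rel2_def)
  show "a - b = a + - b" by (rule minus_Q2_def)
  show "a * b * c = a * (b * c)" by transfer (simp add: mult.assoc rel2_def cauchy2_mult)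
  show "a * b = b * a" by transfer (simp add: mult.commute rel2_def cauchy2_mult)
  show "1 * a = a" by transfer simp
  show "(a + b) * c = a * c + b * c" by transfer (simp add: algebra_simps rel2_def cauchy2_mult cauchy2_add)
  show "(0::Q2) \<noteq> 1" by transfer (simp add: rel2_def)
  show "a \<noteq> 0 \<Longrightarrow> inverse a * a = 1"
  proof transfer
    fix X assume X: "rel2 X X" and "\<not> rel2 X (\<lambda>n. 0)"
    then have nn: "\<not> null2 X" by (simp add: rel2_def)
    have c: "cauchy2 X" using X by simp
    obtain b N where b: "b > 0" "\<And>n. n \<ge> N \<Longrightarrow> rat_abs2 (X n) > b" using not_null2_bound[OF c nn] by blast
    have "eventually (\<lambda>n. inverse (X n) * X n - 1 = 0) sequentially"
      unfolding eventually_sequentially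
    proof (intro exI allI impI)
      fix n assume "n \<ge> N"
      then have "rat_abs2 (X n) > 0" using b(2)[of n] b(1) by linarith
      then have "X n \<noteq> 0" by auto
      then show "inverse (X n) * X n - 1 = 0" by simp
    qed
    then have "eventually (\<lambda>n. 0 = rat_abs2 (inverse (X n) * X n - 1)) sequentially"
      by (rule eventually_mono) simp
    then have "null2 (\<lambda>n. inverse (X n) * X n - 1)"
      unfolding null2_def by (rule Lim_transform_eventually[OF tendsto_const])
    then show "rel2 (\<lambda>n. (if null2 X then \<lambda>n. 0 else (\<lambda>n. inverse (X n))) n * X n) (\<lambda>n. 1)"
      using nn c by (simp add: rel2_def cauchy2_mult cauchy2_inverse)
  qed
  show "a div b = a * inverse b" by (rule divide_Q2_def)
  show "inverse (0::Q2) = 0" by transfer simp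
qed

end

lemma abs_Q2_add: "cauchy2 X \<Longrightarrow> cauchy2 Y \<Longrightarrow> abs_Q2 X + abs_Q2 Y = abs_Q2 (\<lambda>n. X n + Y n)"
  by (simp add: plus_Q2.abs_eq)
lemma abs_Q2_mult: "cauchy2 X \<Longrightarrow> cauchy2 Y \<Longrightarrow> abs_Q2 X * abs_Q2 Y = abs_Q2 (\<lambda>n. X n * Y n)"
  by (simp add: times_Q2.abs_eq)
lemma abs_Q2_minus: "cauchy2 X \<Longrightarrow> - abs_Q2 X = abs_Q2 (\<lambda>n. - X n)"
  by (simp add: uminus_Q2.abs_eq)
lemma abs_Q2_diff: "cauchy2 X \<Longrightarrow> cauchy2 Y \<Longrightarrow> abs_Q2 X - abs_Q2 Y = abs_Q2 (\<lambda>n. X n - Y n)"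
  by (simp add: minus_Q2_def abs_Q2_add abs_Q2_minus cauchy2_minus)

lemma of_nat_Q2: "of_nat k = abs_Q2 (\<lambda>n. of_nat k)"
  by (induction k) (simp_all add: zero_Q2_def one_Q2_def abs_Q2_add)

instance Q2 :: field_char_0
proof
  show "inj (of_nat :: nat \<Rightarrow> Q2)"
    by (rule injI) (simp add: of_nat_Q2 Q2_eqI rel2_def)
qed

lemma of_int_Q2: "of_int k = abs_Q2 (\<lambda>n. of_int k)"
  by (cases k rule: int_diff_cases) (simp add: of_nat_Q2 abs_Q2_diff)

lemma of_rat_Q2: "of_rat r = abs_Q2 (\<lambda>n. r)"
proof -
  obtain a b :: int where r: "r = of_int a / of_int b" "b > 0" by (rule rat_cases_frac)
  have "of_rat r * of_int b = (of_int a :: Q2)" using r by (simp add: of_rat_divide)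
  moreover have "abs_Q2 (\<lambda>n. r) * of_int b = of_int a" using r by (simp add: of_int_Q2 abs_Q2_mult)
  moreover have "(of_int b :: Q2) \<noteq> 0" using r by simp
  ultimately show ?thesis by (metis mult_right_cancel[of "of_int b :: Q2"])
qed

lift_definition abs2 :: "Q2 \<Rightarrow> real" is "\<lambda>X. lim (\<lambda>n. rat_abs2 (X n))"
proof -
  fix X Y assume *: "rel2 X Y"
  obtain L where L: "(\<lambda>n. rat_abs2 (X n)) \<longlonglongrightarrow> L"
    using * cauchy2_abs_convergent by (auto simp: convergent_def rel2_def)
  have "(\<lambda>n. rat_abs2 (X n) - rat_abs2 (Y n)) \<longlonglongrightarrow> 0"
    by (rule Lim_null_comparison[where g = "\<lambda>n. rat_abs2 (X n - Y n)"])
       (use * in \<open>auto simp: rel2_def null2_def rat_abs2_abs_diff\<close>)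
  from tendsto_diff[OF L this] have "(\<lambda>n. rat_abs2 (Y n)) \<longlonglongrightarrow> L" by simp
  with L show "lim (\<lambda>n. rat_abs2 (X n)) = lim (\<lambda>n. rat_abs2 (Y n))" by (simp add: limI)
qed

lemma abs2_lim: "cauchy2 X \<Longrightarrow> (\<lambda>n. rat_abs2 (X n)) \<longlonglongrightarrow> abs2 (abs_Q2 X)"
  using cauchy2_abs_convergent[of X] by (simp add: abs2.abs_eq convergent_LIMSEQ_iff)

lemma abs2_of_rat [simp]: "abs2 (of_rat r :: Q2) = rat_abs2 r"
  using LIMSEQ_unique[OF abs2_lim[OF cauchy2_const] tendsto_const, of r] by (simp add: of_rat_Q2)

lemma abs2_eq_0 [simp]: "abs2 (x :: Q2) = 0 \<longleftrightarrow> x = 0"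
proof (cases x rule: Q2_exhaust)
  case (1 X)
  have "x = 0 \<longleftrightarrow> null2 X" using 1 by (simp add: zero_Q2_def Q2_eqI rel2_def)
  also have "\<dots> \<longleftrightarrow> abs2 x = 0"
  proof
    assume "null2 X"
    then show "abs2 x = 0" unfolding 1(2) null2_def by (rule LIMSEQ_unique[OF abs2_lim[OF 1(1)]])
  next
    assume "abs2 x = 0"
    then show "null2 X" using abs2_lim[OF 1(1)] unfolding 1(2) null2_def by simp
  qed
  finally show ?thesis by simp
qed

lemma abs2_0 [simp]: "abs2 (0 :: Q2) = 0" by simp

lemma abs2_nonneg [simp]: "abs2 (x :: Q2) \<ge> 0"
proof (cases x rule: Q2_exhaust)
  case (1 X)
  show ?thesis unfolding 1(2) by (rule LIMSEQ_le_const[OF abs2_lim[OF 1(1)]]) simp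
qed

lemma abs2_mult: "abs2 (x * y :: Q2) = abs2 x * abs2 y"
proof (cases x rule: Q2_exhaust)
  case (1 X) note X = this
  show ?thesis
  proof (cases y rule: Q2_exhaust)
    case (1 Y)
    have "(\<lambda>n. rat_abs2 (X n) * rat_abs2 (Y n)) \<longlonglongrightarrow> abs2 (x * y)"
      using abs2_lim[OF cauchy2_mult[OF X(1) 1(1)]] X 1 by (simp add: abs_Q2_mult rat_abs2_mult)
    moreover have "(\<lambda>n. rat_abs2 (X n) * rat_abs2 (Y n)) \<longlonglongrightarrow> abs2 x * abs2 y"
      using X 1 by (auto intro!: tendsto_mult abs2_lim)
    ultimately show ?thesis by (rule LIMSEQ_unique)
  qed
qed

lemma abs2_add: "abs2 (x + y :: Q2) \<le> max (abs2 x) (abs2 y)"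
proof (cases x rule: Q2_exhaust)
  case (1 X) note X = this
  show ?thesis
  proof (cases y rule: Q2_exhaust)
    case (1 Y)
    have "(\<lambda>n. rat_abs2 (X n + Y n)) \<longlonglongrightarrow> abs2 (x + y)"
      using abs2_lim[OF cauchy2_add[OF X(1) 1(1)]] X 1 by (simp add: abs_Q2_add)
    moreover have "(\<lambda>n. max (rat_abs2 (X n)) (rat_abs2 (Y n))) \<longlonglongrightarrow> max (abs2 x) (abs2 y)"
      using X 1 by (auto intro!: tendsto_max abs2_lim)
    ultimately show ?thesis by (rule LIMSEQ_le) (auto intro: rat_abs2_add)
  qed
qed

lemma abs2_minus [simp]: "abs2 (- x :: Q2) = abs2 x"
proof -
  have "abs2 (-1 :: Q2) = 1" using abs2_of_rat[of "-1"] by simp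
  then show ?thesis using abs2_mult[of "-1" x] by simp
qed

lemma abs2_minus_commute: "abs2 (x - y :: Q2) = abs2 (y - x)"
  using abs2_minus[of "x - y"] by simp

lemma abs2_diff: "abs2 (x - y :: Q2) \<le> max (abs2 x) (abs2 y)"
  using abs2_add[of x "- y"] by simp

instantiation Q2 :: metric_space
begin

definition dist_Q2 :: "Q2 \<Rightarrow> Q2 \<Rightarrow> real" where
  "dist_Q2 x y = abs2 (x - y)"

definition uniformity_Q2 :: "(Q2 \<times> Q2) filter" where
  "uniformity_Q2 = (INF e\<in>{0<..}. principal {(x, y). dist x y < e})"

definition open_Q2 :: "Q2 set \<Rightarrow> bool" where
  "open_Q2 U \<longleftrightarrow> (\<forall>x\<in>U. eventually (\<lambda>(x', y). x' = x \<longrightarrow> y \<in> U) uniformity)"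

instance
proof
  fix x y z :: Q2
  show "dist x y = 0 \<longleftrightarrow> x = y" by (simp add: dist_Q2_def)
  have "abs2 ((x - z) + (z - y)) \<le> max (abs2 (x - z)) (abs2 (z - y))" by (rule abs2_add)
  also have "\<dots> \<le> abs2 (x - z) + abs2 (y - z)" by (simp add: abs2_minus_commute[of z y])
  finally show "dist x y \<le> dist x z + dist y z" by (simp add: dist_Q2_def)
qed (simp_all only: uniformity_Q2_def open_Q2_def)

end

lemma Q2_rat_dense: assumes "e > 0" shows "\<exists>r. abs2 (x - of_rat r) < e"
proof (cases x rule: Q2_exhaust)
  case (1 X)
  have "e / 2 > 0" using assms by simp
  then obtain N where N: "\<forall>m\<ge>N. \<forall>n\<ge>N. rat_abs2 (X m - X n) < e / 2"
    using 1(1) unfolding cauchy2_def by meson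
  have "cauchy2 (\<lambda>n. X n - X N)"
    using cauchy2_add[OF 1(1) cauchy2_const[of "- X N"]] by simp
  from abs2_lim[OF this] have "(\<lambda>n. rat_abs2 (X n - X N)) \<longlonglongrightarrow> abs2 (x - of_rat (X N))"
    by (simp only: of_rat_Q2 1(2) abs_Q2_diff[OF 1(1) cauchy2_const])
  then have "abs2 (x - of_rat (X N)) \<le> e / 2"
  proof (rule LIMSEQ_le_const2)
    have "\<forall>n\<ge>N. rat_abs2 (X n - X N) \<le> e / 2"
      using N by (meson less_imp_le order_refl)
    then show "\<exists>K. \<forall>n\<ge>K. rat_abs2 (X n - X N) \<le> e / 2" by blast
  qed
  then show ?thesis using assms by (intro exI[of _ "X N"]) linarith
qed

lemma abs2_of_int: "abs2 (of_int a) = rat_abs2 (of_int a)"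
  using abs2_of_rat[of "of_int a"] by simp

lemma abs2_of_int_le1: "abs2 (of_int a) \<le> 1"
  by (simp add: abs2_of_int rat_abs2_of_int_le1)

lemma abs2_of_int_le_iff: "abs2 (of_int a) \<le> (1 / 2) ^ k \<longleftrightarrow> 2 ^ k dvd a"
  using rat_abs2_of_int_le_iff[of a k] by (simp add: abs2_of_int power_int_minus power_one_over field_simps)

lemma abs2_1 [simp]: "abs2 1 = 1"
  using abs2_of_rat[of 1] by simp

lemma abs2_power: "abs2 (x ^ k) = abs2 x ^ k"
  by (induction k) (simp_all add: abs2_mult)

lemma abs2_inverse: "abs2 (inverse x) = inverse (abs2 x)"
proof (cases "x = 0")
  case False
  have "abs2 x * abs2 (inverse x) = 1" using False by (simp flip: abs2_mult)
  then show ?thesis by (rule inverse_unique[symmetric])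
qed simp

lemma abs2_divide: "abs2 (x / y) = abs2 x / abs2 y"
  by (simp only: divide_inverse abs2_mult abs2_inverse)

lemma abs2_2: "abs2 2 = 1 / 2"
  using abs2_of_rat[of 2] rat_abs2_2 by simp

lemma abs2_2_power: "abs2 (2 ^ k) = (1 / 2) ^ k"
  by (simp only: abs2_power abs2_2)

lemma abs2_diff_trans:
  assumes "abs2 (x - y) \<le> e" "abs2 (y - z) \<le> e"
  shows "abs2 (x - z) \<le> e"
  using abs2_add[of "x - y" "y - z"] assms by simp

lemma rat_int_approx:
  assumes "rat_abs2 r \<le> 1"
  shows "\<exists>N. rat_abs2 (r - of_int N) \<le> (1 / 2) ^ k"
proof (cases "r = 0")
  case False
  obtain p q where pq: "quotient_of r = (p, q)" by (cases "quotient_of r")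
  have q: "q > 0" and r: "r = of_int p / of_int q" and cop: "coprime p q"
    using quotient_of_denom_pos[OF pq] quotient_of_div[OF pq] quotient_of_coprime[OF pq] by auto
  have p: "p \<noteq> 0" using False r by auto
  have "odd q"
  proof
    assume "even q"
    then have "odd p" using cop by (metis coprime_common_divisor odd_one)
    then have "multiplicity 2 p = 0" by (rule not_dvd_imp_multiplicity_0)
    moreover have "multiplicity 2 q \<ge> 1" using \<open>even q\<close> q by (intro multiplicity_geI) auto
    ultimately have "(1::real) < 2 powi (int (multiplicity 2 q) - int (multiplicity 2 p))"
      by (intro one_less_power_int) auto
    then show False using assms rat_abs2_divide[OF p, of q] q r by simp
  qed
  then have "coprime q (2 ^ k)" by simp
  then have "gcd q (2 ^ k) = 1" by simp
  then obtain c u where "c * q + u * 2 ^ k = 1" using bezout_int[of q "2 ^ k"] by auto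
  then have "1 - q * c = 2 ^ k * u" by (simp add: algebra_simps)
  then have d: "2 ^ k dvd 1 - q * c" by (rule dvdI)
  have vq: "rat_abs2 (of_int q) = 1"
    using \<open>odd q\<close> q rat_abs2_of_int[of q] by (simp add: not_dvd_imp_multiplicity_0)
  have "r - of_int (p * c) = of_int (p * (1 - q * c)) / of_int q"
    using q by (simp add: r field_simps)
  then have "rat_abs2 (r - of_int (p * c)) = rat_abs2 (of_int (p * (1 - q * c)))"
    using vq by (simp only: divide_inverse rat_abs2_mult rat_abs2_inverse) simp
  also have "\<dots> \<le> (1 / 2) ^ k"
  proof -
    have "2 ^ k dvd p * (1 - q * c)" using d by (rule dvd_mult)
    then show ?thesis by (simp only: abs2_of_int_le_iff[symmetric] abs2_of_int)
  qed
  finally show ?thesis by blast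
qed (auto intro: exI[of _ 0])

lemma Z2_nat_approx:
  assumes "abs2 x \<le> 1"
  shows "\<exists>N::nat. N < 2 ^ k \<and> abs2 (x - of_nat N) \<le> (1 / 2) ^ k"
proof -
  obtain r where r: "abs2 (x - of_rat r) < (1 / 2) ^ k" using Q2_rat_dense[of "(1/2)^k" x] by auto
  have "(1 / 2 :: real) ^ k \<le> 1" by (simp add: power_le_one)
  with r have "abs2 (of_rat r - x) \<le> 1" by (simp add: abs2_minus_commute)
  from abs2_add[of "of_rat r - x" x] this assms have "rat_abs2 r \<le> 1" by simp
  then obtain M where M: "rat_abs2 (r - of_int M) \<le> (1 / 2) ^ k" using rat_int_approx by blast
  define N where "N = nat (M mod 2 ^ k)"
  have N: "int N = M mod 2 ^ k" by (simp add: N_def)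
  have "2 ^ k dvd M - int N" by (simp add: N dvd_minus_mod)
  then have "abs2 (of_int (M - int N)) \<le> (1 / 2) ^ k" by (simp only: abs2_of_int_le_iff)
  then have 1: "abs2 (of_int M - of_nat N) \<le> (1 / 2) ^ k" by simp
  have "abs2 (of_rat (r - of_int M)) \<le> (1 / 2) ^ k" using M by (simp only: abs2_of_rat)
  then have 2: "abs2 (of_rat r - of_int M) \<le> (1 / 2) ^ k" by (simp add: of_rat_diff)
  have "int N < 2 ^ k" by (simp add: N)
  then have "N < 2 ^ k" by (metis of_nat_less_iff of_nat_numeral of_nat_power)
  moreover have "abs2 (x - of_nat N) \<le> (1 / 2) ^ k"
    using abs2_diff_trans[OF abs2_diff_trans[OF less_imp_le[OF r] 2] 1] .
  ultimately show ?thesis by blast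
qed

text \<open>The fractional part of \<open>t\<close> is the unique \<open>r \<in> \<int>[1/2] \<inter> [0, 1)\<close> with \<open>t - r \<in> \<int>\<^sub>2\<close>, that is, the part of the
  2-adic expansion of \<open>t\<close> with negative exponents; see \<open>frac2_ex1\<close>.\<close>

definition dyadic_unit :: "rat set" where
  "dyadic_unit = {of_nat m / 2 ^ \<gamma> | m \<gamma> :: nat. m < 2 ^ \<gamma>}"

definition frac2 :: "Q2 \<Rightarrow> rat" where
  "frac2 t = (THE r. r \<in> dyadic_unit \<and> abs2 (t - of_rat r) \<le> 1)"

lemma frac2_ex1: "\<exists>!r. r \<in> dyadic_unit \<and> abs2 (t - of_rat r) \<le> 1"
proof (rule ex_ex1I)
  obtain \<gamma> where g: "abs2 t < 2 ^ \<gamma>" using real_arch_pow[of 2 "abs2 t"] by auto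
  have "abs2 (2 ^ \<gamma> * t) \<le> 1" using g by (simp add: abs2_mult abs2_2_power power_one_over field_simps)
  then obtain N where N: "N < 2 ^ \<gamma>" "abs2 (2 ^ \<gamma> * t - of_nat N) \<le> (1 / 2) ^ \<gamma>" using Z2_nat_approx by blast
  have "t - of_rat (of_nat N / 2 ^ \<gamma>) = (2 ^ \<gamma> * t - of_nat N) / 2 ^ \<gamma>"
    by (simp add: of_rat_divide of_rat_power field_simps)
  then have "abs2 (t - of_rat (of_nat N / 2 ^ \<gamma>)) = abs2 (2 ^ \<gamma> * t - of_nat N) / (1 / 2) ^ \<gamma>"
    by (simp only: abs2_divide abs2_2_power)
  also have "\<dots> \<le> 1" using N by (simp add: power_one_over field_simps)
  finally show "\<exists>r. r \<in> dyadic_unit \<and> abs2 (t - of_rat r) \<le> 1" using N(1) unfolding dyadic_unit_def by blast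
next
  fix r s assume rs: "r \<in> dyadic_unit \<and> abs2 (t - of_rat r) \<le> 1" "s \<in> dyadic_unit \<and> abs2 (t - of_rat s) \<le> 1"
  obtain m a where r: "r = of_nat m / 2 ^ a" "m < 2 ^ a" using rs by (auto simp: dyadic_unit_def)
  obtain n b where s: "s = of_nat n / 2 ^ b" "n < 2 ^ b" using rs by (auto simp: dyadic_unit_def)
  define d where "d = int m * 2 ^ b - int n * 2 ^ a"
  have "abs2 (of_rat r - t) \<le> 1" using rs by (simp add: abs2_minus_commute)
  then have "abs2 (of_rat r - of_rat s) \<le> 1" using rs abs2_diff_trans by blast
  then have le: "rat_abs2 (r - s) \<le> 1" by (simp flip: of_rat_diff)
  have dr: "of_int d = (r - s) * 2 ^ (a + b)" by (simp add: d_def r s power_add left_diff_distrib)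
  then have "rat_abs2 (of_int d) = rat_abs2 (r - s) * rat_abs2 (of_int (2 ^ (a + b)))" by (simp add: rat_abs2_mult)
  also have "\<dots> \<le> 1 * rat_abs2 (of_int (2 ^ (a + b)))" using le by (intro mult_right_mono) auto
  also have "rat_abs2 (of_int (2 ^ (a + b))) = (1 / 2) ^ (a + b)" using abs2_2_power[of "a + b"] abs2_of_int[of "2 ^ (a + b)"] by simp
  finally have "abs2 (of_int d) \<le> (1 / 2) ^ (a + b)" by (simp add: abs2_of_int)
  then have dvd: "2 ^ (a + b) dvd d" by (simp only: abs2_of_int_le_iff)
  have "int m < 2 ^ a" "int n < 2 ^ b" using r(2) s(2) by (metis of_nat_less_iff of_nat_numeral of_nat_power)+
  then have "int m * 2 ^ b < 2 ^ a * 2 ^ b" "int n * 2 ^ a < 2 ^ b * 2 ^ a" by simp_all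
  moreover have "int m * 2 ^ b \<ge> 0" "int n * 2 ^ a \<ge> 0" by auto
  moreover have "(2::int) ^ (a + b) = 2 ^ a * 2 ^ b" "(2::int) ^ b * 2 ^ a = 2 ^ a * 2 ^ b"
    by (simp_all add: power_add)
  ultimately have lt: "\<bar>d\<bar> < 2 ^ (a + b)" unfolding d_def by linarith
  have "d = 0"
  proof (rule ccontr)
    assume "d \<noteq> 0"
    from dvd_imp_le_int[OF this dvd] lt show False by simp
  qed
  then have "(r - s) * 2 ^ (a + b) = 0" using dr by simp
  then show "r = s" by simp
qed

lemma frac2: "frac2 t \<in> dyadic_unit" "abs2 (t - of_rat (frac2 t)) \<le> 1"
  using theI'[OF frac2_ex1[of t]] unfolding frac2_def by blast+

lemma frac2_eqI: "r \<in> dyadic_unit \<Longrightarrow> abs2 (t - of_rat r) \<le> 1 \<Longrightarrow> frac2 t = r"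
  unfolding frac2_def by (rule the1_equality[OF frac2_ex1]) (rule conjI)

definition Q2_ball :: "Q2 \<Rightarrow> nat \<Rightarrow> Q2 set" where
  "Q2_ball c k = {x. abs2 (x - c) \<le> (1 / 2) ^ k}"

lemma Q2_ball_center [simp]: "c \<in> Q2_ball c k" by (simp add: Q2_ball_def)

lemma Q2_ball_eq: "y \<in> Q2_ball c k \<Longrightarrow> Q2_ball y k = Q2_ball c k"
  unfolding Q2_ball_def
proof safe
  fix x assume y: "abs2 (y - c) \<le> (1 / 2) ^ k"
  { assume "abs2 (x - y) \<le> (1 / 2) ^ k"
    from abs2_diff_trans[OF this y] show "abs2 (x - c) \<le> (1 / 2) ^ k" . }
  assume x: "abs2 (x - c) \<le> (1 / 2) ^ k"
  have "abs2 (c - y) \<le> (1 / 2) ^ k" using y by (simp only: abs2_minus_commute)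
  from abs2_diff_trans[OF x this] show "abs2 (x - y) \<le> (1 / 2) ^ k" .
qed

lemma Q2_ball_mono: "k \<le> l \<Longrightarrow> Q2_ball c l \<subseteq> Q2_ball c k"
proof
  fix x assume "k \<le> l" and x: "x \<in> Q2_ball c l"
  then have "(1 / 2 :: real) ^ l \<le> (1 / 2) ^ k" by (intro power_decreasing) auto
  moreover have "abs2 (x - c) \<le> (1 / 2) ^ l" using x by (simp only: Q2_ball_def mem_Collect_eq)
  ultimately have "abs2 (x - c) \<le> (1 / 2) ^ k" by linarith
  then show "x \<in> Q2_ball c k" by (simp only: Q2_ball_def mem_Collect_eq)
qed

lemma Q2_ball_Int: "Q2_ball c k \<inter> Q2_ball d l \<in> {{}, Q2_ball c k, Q2_ball d l}"
proof (cases "Q2_ball c k \<inter> Q2_ball d l = {}")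
  case False
  then obtain y where "y \<in> Q2_ball c k" "y \<in> Q2_ball d l" by blast
  then have "Q2_ball c k = Q2_ball y k" "Q2_ball d l = Q2_ball y l" using Q2_ball_eq by auto
  then show ?thesis using Q2_ball_mono[of k l y] Q2_ball_mono[of l k y] by (cases "k \<le> l") auto
qed simp

lemma Q2_ball_translate: "(\<lambda>x. a + x) ` Q2_ball c k = Q2_ball (a + c) k"
proof -
  have "x \<in> (\<lambda>x. a + x) ` Q2_ball c k" if "x \<in> Q2_ball (a + c) k" for x
  proof (rule image_eqI)
    show "x = a + (x - a)" by simp
    have "x - a - c = x - (a + c)" by simp
    then show "x - a \<in> Q2_ball c k" using that by (simp only: Q2_ball_def mem_Collect_eq)
  qed
  moreover have "a + x \<in> Q2_ball (a + c) k" if "x \<in> Q2_ball c k" for x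
    using that by (simp add: Q2_ball_def)
  ultimately show ?thesis by blast
qed

lemma open_Q2_ball: "open (Q2_ball c k)"
  unfolding open_dist
proof
  fix x assume x: "x \<in> Q2_ball c k"
  have "y \<in> Q2_ball c k" if "dist y x < (1 / 2) ^ k" for y
  proof -
    have "y \<in> Q2_ball x k" using that by (simp add: Q2_ball_def dist_Q2_def)
    then show ?thesis by (simp only: Q2_ball_eq[OF x])
  qed
  moreover have "(0::real) < (1 / 2) ^ k" by simp
  ultimately show "\<exists>e>0. \<forall>y. dist y x < e \<longrightarrow> y \<in> Q2_ball c k" by blast
qed

definition Q2_basis :: "Q2 set set" where
  "Q2_basis = (\<lambda>(r, k). Q2_ball (of_rat r) k) ` UNIV"

lemma countable_Q2_basis: "countable Q2_basis"
  unfolding Q2_basis_def by (intro countable_image) auto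

lemma Q2_ball_in_basis: "Q2_ball c k \<in> Q2_basis"
proof -
  obtain r where "abs2 (c - of_rat r) < (1 / 2) ^ k" using Q2_rat_dense[of "(1/2)^k" c] by auto
  then have "c \<in> Q2_ball (of_rat r) k" by (simp add: Q2_ball_def)
  then have "Q2_ball c k = Q2_ball (of_rat r) k" by (rule Q2_ball_eq)
  then show ?thesis by (auto simp: Q2_basis_def)
qed

lemma topological_basis_Q2: "topological_basis Q2_basis"
proof (rule topological_basisI)
  show "open B" if "B \<in> Q2_basis" for B using that by (auto simp: Q2_basis_def open_Q2_ball)
next
  fix U :: "Q2 set" and x assume "open U" "x \<in> U"
  then obtain e where e: "e > 0" "\<And>y. dist y x < e \<Longrightarrow> y \<in> U" unfolding open_dist by blast
  obtain k where k: "(1 / 2 :: real) ^ k < e" using real_arch_pow_inv[OF e(1), of "1/2"] by auto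
  have "Q2_ball x k \<subseteq> U" using k e(2) by (auto simp: Q2_ball_def dist_Q2_def)
  then show "\<exists>B\<in>Q2_basis. x \<in> B \<and> B \<subseteq> U" using Q2_ball_in_basis by (intro bexI[of _ "Q2_ball x k"]) auto
qed

instance Q2 :: second_countable_topology
proof
  show "\<exists>B::Q2 set set. countable B \<and> open = generate_topology B"
    using countable_Q2_basis topological_basis_imp_subbasis[OF topological_basis_Q2] by blast
qed

lemma borel_Q2: "borel = sigma UNIV Q2_basis"
  by (rule borel_eq_countable_basis[OF countable_Q2_basis topological_basis_Q2])

lemma Q2_ball_measurable [measurable]: "Q2_ball c k \<in> sets borel"
  using open_Q2_ball by simp

definition normalized_haar :: "Q2 measure \<Rightarrow> bool" where
  "normalized_haar \<mu> \<longleftrightarrow> sets \<mu> = sets borel \<and>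
     (\<forall>a. \<forall>A\<in>sets borel. emeasure \<mu> ((\<lambda>x. a + x) ` A) = emeasure \<mu> A) \<and>
     emeasure \<mu> {x. abs2 x \<le> 1} = 1"

text \<open>Existence and uniqueness are established in \<open>normalized_haar_exists\<close> and
  \<open>normalized_haar_unique\<close>.\<close>

definition haar :: "Q2 measure" where
  "haar = (THE \<mu>. normalized_haar \<mu>)"

lemma sets_borel_Q2: "sets (borel :: Q2 measure) = sigma_sets UNIV (insert {} Q2_basis)"
proof -
  have "topological_basis (insert {} Q2_basis)"
  proof (rule topological_basisI)
    fix B assume "B \<in> insert {} Q2_basis"
    then show "open B" using topological_basis_open[OF topological_basis_Q2] by auto
  next
    fix U x assume "open U" "(x :: Q2) \<in> U"
    then show "\<exists>B\<in>insert {} Q2_basis. x \<in> B \<and> B \<subseteq> U"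
      using topological_basisE[OF topological_basis_Q2] by (metis insertI2)
  qed
  then have "borel = sigma UNIV (insert {} Q2_basis)"
    using countable_Q2_basis by (intro borel_eq_countable_basis) auto
  then have "sets borel = sets (sigma UNIV (insert {} Q2_basis))" by (rule arg_cong)
  also have "\<dots> = sigma_sets UNIV (insert {} Q2_basis)" by (rule sets_measure_of) simp
  finally show ?thesis .
qed

lemma Q2_basis_ball: "B \<in> Q2_basis \<Longrightarrow> \<exists>c k. B = Q2_ball c k"
  by (auto simp: Q2_basis_def)

lemma Q2_measure_eqI:
  assumes sets: "sets M = sets borel" "sets N = sets borel"
    and M: "\<And>c k. emeasure M (Q2_ball c k) = ennreal ((1 / 2) ^ k)"
    and N: "\<And>c k. emeasure N (Q2_ball c k) = ennreal ((1 / 2) ^ k)"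
  shows "M = N"
proof (rule measure_eqI_generator_eq_countable)
  show "Int_stable (insert {} Q2_basis)"
  proof (rule Int_stableI)
    fix A B assume AB: "A \<in> insert {} Q2_basis" "B \<in> insert {} Q2_basis"
    show "A \<inter> B \<in> insert {} Q2_basis"
    proof (cases "A = {} \<or> B = {}")
      case False
      then obtain c k d l where "A = Q2_ball c k" "B = Q2_ball d l" using AB Q2_basis_ball by (metis insertE)
      then show ?thesis using Q2_ball_Int[of c k d l] Q2_ball_in_basis by auto
    qed auto
  qed
  show "emeasure M X = emeasure N X" if X: "X \<in> insert {} Q2_basis" for X
  proof (cases "X = {}")
    case False
    then obtain c k where "X = Q2_ball c k" using X Q2_basis_ball by blast
    then show ?thesis by (simp only: M N)
  qed simp
  show "sets M = sigma_sets UNIV (insert {} Q2_basis)" "sets N = sigma_sets UNIV (insert {} Q2_basis)"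
    using sets sets_borel_Q2 by simp_all
  show "Q2_basis \<subseteq> insert {} Q2_basis" by auto
  show "\<Union> Q2_basis = UNIV" using Q2_ball_in_basis Q2_ball_center by blast
  show "countable Q2_basis" by (rule countable_Q2_basis)
  show "emeasure M a \<noteq> \<infinity>" if "a \<in> Q2_basis" for a
    using Q2_basis_ball[OF that] M by (metis ennreal_neq_top infinity_ennreal_def)
qed auto

lemma Q2_ball_half: "Q2_ball 0 k = Q2_ball 0 (Suc k) \<union> Q2_ball (2 ^ k) (Suc k)"
  "Q2_ball 0 (Suc k) \<inter> Q2_ball (2 ^ k) (Suc k) = {}"
proof -
  have "x \<in> Q2_ball 0 (Suc k) \<union> Q2_ball (2 ^ k) (Suc k)" if x: "x \<in> Q2_ball 0 k" for x
  proof -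
    define y where "y = x / 2 ^ k"
    have xy: "x = 2 ^ k * y" by (simp add: y_def)
    have "abs2 y \<le> 1" using x by (simp add: y_def Q2_ball_def abs2_divide abs2_2_power)
    then obtain N :: nat where N: "N < 2 ^ 1" "abs2 (y - of_nat N) \<le> (1 / 2) ^ 1" using Z2_nat_approx by blast
    have "x - 2 ^ k * of_nat N = 2 ^ k * (y - of_nat N)" by (simp add: xy right_diff_distrib)
    then have "abs2 (x - 2 ^ k * of_nat N) = (1 / 2) ^ k * abs2 (y - of_nat N)" by (simp only: abs2_mult abs2_2_power)
    also have "\<dots> \<le> (1 / 2) ^ k * (1 / 2) ^ 1" using N(2) by (intro mult_left_mono) auto
    finally have "x \<in> Q2_ball (2 ^ k * of_nat N) (Suc k)" by (simp add: Q2_ball_def)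
    moreover have "N = 0 \<or> N = 1" using N(1) by auto
    ultimately show ?thesis by auto
  qed
  moreover have "Q2_ball (2 ^ k) (Suc k) \<subseteq> Q2_ball 0 k"
  proof -
    have "2 ^ k \<in> Q2_ball 0 k" by (simp add: Q2_ball_def abs2_2_power)
    from Q2_ball_eq[OF this] Q2_ball_mono[of k "Suc k" "2 ^ k"] show ?thesis by simp
  qed
  moreover have "Q2_ball 0 (Suc k) \<subseteq> Q2_ball 0 k" by (rule Q2_ball_mono) simp
  ultimately show "Q2_ball 0 k = Q2_ball 0 (Suc k) \<union> Q2_ball (2 ^ k) (Suc k)" by blast
  show "Q2_ball 0 (Suc k) \<inter> Q2_ball (2 ^ k) (Suc k) = {}"
  proof (rule ccontr)
    assume "\<not> ?thesis"
    then obtain x where "x \<in> Q2_ball 0 (Suc k)" "x \<in> Q2_ball (2 ^ k) (Suc k)" by blast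
    then have "Q2_ball 0 (Suc k) = Q2_ball (2 ^ k) (Suc k)" using Q2_ball_eq by metis
    then have "2 ^ k \<in> Q2_ball 0 (Suc k)" by simp
    then show False by (simp add: Q2_ball_def abs2_2_power)
  qed
qed

lemma normalized_haar_ball:
  assumes "normalized_haar \<mu>"
  shows "emeasure \<mu> (Q2_ball c k) = ennreal ((1 / 2) ^ k)"
proof -
  have sets: "sets \<mu> = sets borel" and inv: "\<And>a c k. emeasure \<mu> (Q2_ball (a + c) k) = emeasure \<mu> (Q2_ball c k)"
    using assms by (simp_all add: normalized_haar_def flip: Q2_ball_translate)
  have "emeasure \<mu> (Q2_ball 0 k) = ennreal ((1 / 2) ^ k)"
  proof (induction k)
    case 0
    have "emeasure \<mu> {x. abs2 x \<le> 1} = 1" using assms by (simp only: normalized_haar_def)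
    then show ?case by (simp add: Q2_ball_def)
  next
    case (Suc k)
    have "emeasure \<mu> (Q2_ball 0 (Suc k)) + emeasure \<mu> (Q2_ball (2 ^ k) (Suc k)) = emeasure \<mu> (Q2_ball 0 k)"
      by (subst Q2_ball_half(1)[of k], rule plus_emeasure) (simp_all add: sets Q2_ball_half(2))
    moreover have "emeasure \<mu> (Q2_ball (2 ^ k) (Suc k)) = emeasure \<mu> (Q2_ball 0 (Suc k))"
      using inv[of "2 ^ k" 0 "Suc k"] by simp
    ultimately have *: "2 * emeasure \<mu> (Q2_ball 0 (Suc k)) = ennreal ((1 / 2) ^ k)"
      using Suc by (simp add: mult_2)
    have "emeasure \<mu> (Q2_ball 0 (Suc k)) < top"
    proof (rule ccontr)
      assume "\<not> ?thesis"
      then have "emeasure \<mu> (Q2_ball 0 (Suc k)) = top" by (metis top.not_eq_extremum)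
      with * show False by (simp add: ennreal_mult_top)
    qed
    then obtain r where r: "r \<ge> 0" "emeasure \<mu> (Q2_ball 0 (Suc k)) = ennreal r" by (cases "emeasure \<mu> (Q2_ball 0 (Suc k))") auto
    have "ennreal (2 * r) = ennreal ((1 / 2) ^ k)" using * r by (simp add: ennreal_mult)
    then have "2 * r = (1 / 2) ^ k" using r(1) by (subst (asm) ennreal_inj) auto
    then have "r = (1 / 2) ^ Suc k" by simp
    then show ?case by (simp only: r(2))
  qed
  then show ?thesis using inv[of c 0 k] by simp
qed

lemma normalized_haar_unique: "normalized_haar \<mu> \<Longrightarrow> normalized_haar \<nu> \<Longrightarrow> \<mu> = \<nu>"
proof (rule Q2_measure_eqI)
  assume *: "normalized_haar \<mu>" "normalized_haar \<nu>"
  show "sets \<mu> = sets borel" using *(1) unfolding normalized_haar_def by blast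
  show "sets \<nu> = sets borel" using *(2) unfolding normalized_haar_def by blast
  show "emeasure \<mu> (Q2_ball c k) = ennreal ((1 / 2) ^ k)" "emeasure \<nu> (Q2_ball c k) = ennreal ((1 / 2) ^ k)" for c k
    using * normalized_haar_ball by blast+
qed

lemma borel_measurable_Q2I:
  assumes "\<And>c k. f -` Q2_ball c k \<inter> space M \<in> sets M"
  shows "f \<in> measurable M (borel :: Q2 measure)"
  unfolding borel_Q2
proof (rule measurable_measure_of)
  fix B assume "B \<in> Q2_basis"
  then show "f -` B \<inter> space M \<in> sets M" using assms Q2_basis_ball by metis
qed auto

lemma translate_measurable_Q2: "(\<lambda>x. a + x) \<in> measurable borel (borel :: Q2 measure)"
proof (rule borel_measurable_Q2I)
  fix c k
  have "(\<lambda>x. a + x) -` Q2_ball c k = Q2_ball (c - a) k"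
    by (auto simp: Q2_ball_def algebra_simps)
  then show "(\<lambda>x. a + x) -` Q2_ball c k \<inter> space borel \<in> sets borel" by simp
qed

lemma normalized_haarI:
  assumes sets: "sets \<mu> = sets borel" and b: "\<And>c k. emeasure \<mu> (Q2_ball c k) = ennreal ((1 / 2) ^ k)"
  shows "normalized_haar \<mu>"
  unfolding normalized_haar_def
proof (intro conjI allI ballI)
  show "sets \<mu> = sets borel" by fact
  show "emeasure \<mu> {x. abs2 x \<le> 1} = 1" using b[of 0 0] by (simp add: Q2_ball_def)
  fix a and A :: "Q2 set" assume A: "A \<in> sets borel"
  have m: "(\<lambda>x. - a + x) \<in> measurable \<mu> borel"
    using translate_measurable_Q2[of "- a"] by (simp only: measurable_cong_sets[OF sets refl])
  have sp: "space \<mu> = UNIV" using sets_eq_imp_space_eq[OF sets] by simp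
  have im: "(\<lambda>x. - a + x) -` B = (\<lambda>x. a + x) ` B" for B
  proof
    show "(\<lambda>x. - a + x) -` B \<subseteq> (\<lambda>x. a + x) ` B"
    proof
      fix x assume "x \<in> (\<lambda>x. - a + x) -` B"
      then have "- a + x \<in> B" by simp
      then show "x \<in> (\<lambda>x. a + x) ` B" by (rule image_eqI[rotated]) simp
    qed
  qed auto
  have "distr \<mu> borel (\<lambda>x. - a + x) = \<mu>"
  proof (rule Q2_measure_eqI)
    show "emeasure (distr \<mu> borel (\<lambda>x. - a + x)) (Q2_ball c k) = ennreal ((1 / 2) ^ k)" for c k
      using m by (simp only: emeasure_distr Q2_ball_measurable im sp Int_UNIV_right Q2_ball_translate b)
  qed (use sets b in simp_all)
  then have "emeasure \<mu> A = emeasure (distr \<mu> borel (\<lambda>x. - a + x)) A" by simp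
  also have "\<dots> = emeasure \<mu> ((\<lambda>x. a + x) ` A)"
    using m A by (simp only: emeasure_distr im sp Int_UNIV_right)
  finally show "emeasure \<mu> ((\<lambda>x. a + x) ` A) = emeasure \<mu> A" by simp
qed

text \<open>Existence: a random 2-adic integer is a sequence of fair coin tosses (its binary digits), and
  \<open>\<rat>\<^sub>2\<close> is the disjoint union of the translates of \<open>\<int>\<^sub>2\<close> by dyadic rationals in \<open>[0, 1)\<close>.\<close>

definition digit_sum :: "(nat \<Rightarrow> bool) \<Rightarrow> nat \<Rightarrow> nat" where
  "digit_sum w k = (\<Sum>i<k. if w i then 2 ^ i else 0)"

lemma digit_sum_Suc: "digit_sum w (Suc k) = digit_sum w k + (if w k then 2 ^ k else 0)"
  by (simp add: digit_sum_def)

lemma digit_sum_less: "digit_sum w k < 2 ^ k"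
  by (induction k) (auto simp: digit_sum_Suc, auto simp: digit_sum_def)

lemma digit_sum_inj: "digit_sum v k = digit_sum w k \<longleftrightarrow> (\<forall>i<k. v i = w i)"
proof (induction k)
  case (Suc k)
  have "digit_sum v (Suc k) = digit_sum w (Suc k) \<longleftrightarrow> digit_sum v k = digit_sum w k \<and> v k = w k"
    using digit_sum_less[of v k] digit_sum_less[of w k] by (auto simp: digit_sum_Suc)
  then show ?case using Suc by (auto simp: less_Suc_eq)
qed (simp add: digit_sum_def)

lemma digit_sum_surj: "N < 2 ^ k \<Longrightarrow> \<exists>w. digit_sum w k = N"
proof (induction k arbitrary: N)
  case (Suc k)
  define b where "b \<longleftrightarrow> 2 ^ k \<le> N"
  have "(if b then N - 2 ^ k else N) < 2 ^ k" using Suc.prems by (auto simp: b_def)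
  then obtain w where w: "digit_sum w k = (if b then N - 2 ^ k else N)" using Suc.IH by blast
  have "digit_sum (w(k := b)) k = digit_sum w k" by (simp add: digit_sum_inj)
  then have "digit_sum (w(k := b)) (Suc k) = N" using w by (auto simp: digit_sum_Suc b_def)
  then show ?case by blast
qed (simp add: digit_sum_def)

lemma digit_sum_dvd: "k \<le> n \<Longrightarrow> 2 ^ k dvd int (digit_sum w n) - int (digit_sum w k)"
proof (induction n)
  case (Suc n)
  show ?case
  proof (cases "k = Suc n")
    case False
    then have kn: "k \<le> n" using Suc by simp
    have "int (digit_sum w (Suc n)) - int (digit_sum w k) = (int (digit_sum w n) - int (digit_sum w k)) + (if w n then 2 ^ n else 0)"
      by (simp add: digit_sum_Suc)
    moreover have "2 ^ k dvd (if w n then 2 ^ n else 0 :: int)" using kn by (simp add: le_imp_power_dvd)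
    ultimately show ?thesis using Suc.IH[OF kn] by (metis dvd_add)
  qed simp
qed simp

lemma rat_abs2_digit_sum:
  assumes "k \<le> n"
  shows "rat_abs2 (of_nat (digit_sum w n) - of_nat (digit_sum w k)) \<le> (1 / 2) ^ k"
proof -
  have "abs2 (of_int (int (digit_sum w n) - int (digit_sum w k))) \<le> (1 / 2) ^ k"
    using digit_sum_dvd[OF assms] by (simp only: abs2_of_int_le_iff)
  then have "rat_abs2 (of_int (int (digit_sum w n) - int (digit_sum w k))) \<le> (1 / 2) ^ k" by (simp only: abs2_of_int)
  then show ?thesis by simp
qed

definition Z2_of_digits :: "(nat \<Rightarrow> bool) \<Rightarrow> Q2" where
  "Z2_of_digits w = abs_Q2 (\<lambda>n. of_nat (digit_sum w n))"

lemma cauchy2_digit_sum: "cauchy2 (\<lambda>n. of_nat (digit_sum w n))"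
  unfolding cauchy2_def
proof safe
  fix e :: real assume "e > 0"
  then obtain k where k: "(1 / 2) ^ k < e" using real_arch_pow_inv[of e "1/2"] by auto
  have "rat_abs2 (of_nat (digit_sum w m) - of_nat (digit_sum w n)) < e" if mn: "m \<ge> k" "n \<ge> k" for m n
  proof -
    have "of_nat (digit_sum w m) - of_nat (digit_sum w n)
        = (of_nat (digit_sum w m) - of_nat (digit_sum w k)) - (of_nat (digit_sum w n) - of_nat (digit_sum w k) :: rat)" by simp
    then have "rat_abs2 (of_nat (digit_sum w m) - of_nat (digit_sum w n))
      \<le> max (rat_abs2 (of_nat (digit_sum w m) - of_nat (digit_sum w k))) (rat_abs2 (of_nat (digit_sum w n) - of_nat (digit_sum w k)))"
      by (metis rat_abs2_diff)
    then show ?thesis using rat_abs2_digit_sum[OF mn(1), of w] rat_abs2_digit_sum[OF mn(2), of w] k by linarith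
  qed
  then show "\<exists>N. \<forall>m\<ge>N. \<forall>n\<ge>N. rat_abs2 (of_nat (digit_sum w m) - of_nat (digit_sum w n)) < e" by blast
qed

lemma Z2_of_digits_approx: "abs2 (Z2_of_digits w - of_nat (digit_sum w k)) \<le> (1 / 2) ^ k"
proof -
  have c: "cauchy2 (\<lambda>n. of_nat (digit_sum w n) - of_nat (digit_sum w k))"
    using cauchy2_add[OF cauchy2_digit_sum cauchy2_const[of "- of_nat (digit_sum w k)"]] by simp
  have "Z2_of_digits w - of_nat (digit_sum w k) = abs_Q2 (\<lambda>n. of_nat (digit_sum w n) - of_nat (digit_sum w k))"
    unfolding Z2_of_digits_def of_nat_Q2 by (rule abs_Q2_diff[OF cauchy2_digit_sum cauchy2_const])
  with abs2_lim[OF c] have "(\<lambda>n. rat_abs2 (of_nat (digit_sum w n) - of_nat (digit_sum w k))) \<longlonglongrightarrow> abs2 (Z2_of_digits w - of_nat (digit_sum w k))"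
    by simp
  then show ?thesis
  proof (rule LIMSEQ_le_const2)
    show "\<exists>N. \<forall>n\<ge>N. rat_abs2 (of_nat (digit_sum w n) - of_nat (digit_sum w k)) \<le> (1 / 2) ^ k"
      using rat_abs2_digit_sum by blast
  qed
qed

lemma Z2_of_digits_ball:
  assumes "abs2 c \<le> 1"
  shows "\<exists>v. \<forall>w. Z2_of_digits w \<in> Q2_ball c k \<longleftrightarrow> (\<forall>i<k. w i = v i)"
proof -
  obtain N where N: "N < 2 ^ k" "abs2 (c - of_nat N) \<le> (1 / 2) ^ k" using Z2_nat_approx[OF assms] by blast
  obtain v where v: "digit_sum v k = N" using digit_sum_surj[OF N(1)] by blast
  have "Z2_of_digits w \<in> Q2_ball c k \<longleftrightarrow> digit_sum w k = N" for w
  proof -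
    have cN: "of_nat N \<in> Q2_ball c k" using N(2) by (simp add: Q2_ball_def abs2_minus_commute)
    have wk: "Z2_of_digits w \<in> Q2_ball (of_nat (digit_sum w k)) k" using Z2_of_digits_approx by (simp add: Q2_ball_def)
    have "Z2_of_digits w \<in> Q2_ball c k \<longleftrightarrow> of_nat (digit_sum w k) \<in> Q2_ball (of_nat N) k"
    proof
      assume "Z2_of_digits w \<in> Q2_ball c k"
      from Q2_ball_eq[OF this] Q2_ball_eq[OF wk] Q2_ball_eq[OF cN]
      have "Q2_ball (of_nat (digit_sum w k)) k = Q2_ball (of_nat N) k" by simp
      then show "of_nat (digit_sum w k) \<in> Q2_ball (of_nat N) k" using Q2_ball_center by blast
    next
      assume "of_nat (digit_sum w k) \<in> Q2_ball (of_nat N) k"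
      from Q2_ball_eq[OF this] Q2_ball_eq[OF cN] wk show "Z2_of_digits w \<in> Q2_ball c k" by simp
    qed
    also have "\<dots> \<longleftrightarrow> abs2 (of_int (int (digit_sum w k) - int N)) \<le> (1 / 2) ^ k" by (simp add: Q2_ball_def)
    also have "\<dots> \<longleftrightarrow> 2 ^ k dvd int (digit_sum w k) - int N" by (rule abs2_of_int_le_iff)
    also have "\<dots> \<longleftrightarrow> digit_sum w k = N"
    proof
      assume d: "2 ^ k dvd int (digit_sum w k) - int N"
      have "int (digit_sum w k) < 2 ^ k" using digit_sum_less[of w k] by (metis of_nat_less_iff of_nat_numeral of_nat_power)
      moreover have "int N < 2 ^ k" using N(1) by (metis of_nat_less_iff of_nat_numeral of_nat_power)
      ultimately have lt: "\<bar>int (digit_sum w k) - int N\<bar> < 2 ^ k" by linarith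
      have "int (digit_sum w k) - int N = 0"
      proof (rule ccontr)
        assume "int (digit_sum w k) - int N \<noteq> 0"
        from dvd_imp_le_int[OF this d] lt show False by simp
      qed
      then show "digit_sum w k = N" by simp
    qed simp
    finally show ?thesis .
  qed
  then show ?thesis using v digit_sum_inj by metis
qed

lemma normalized_haar_exists: "\<exists>\<mu>. normalized_haar \<mu>"
proof -
  define C :: "(nat \<Rightarrow> bool) measure" where "C = PiM UNIV (\<lambda>_. measure_pmf (bernoulli_pmf (1 / 2)))"
  define P where "P = count_space dyadic_unit \<Otimes>\<^sub>M C"
  define f :: "rat \<times> (nat \<Rightarrow> bool) \<Rightarrow> Q2" where "f = (\<lambda>(r, w). of_rat r + Z2_of_digits w)"
  interpret product_prob_space "\<lambda>_::nat. measure_pmf (bernoulli_pmf (1 / 2))" UNIV ..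
  have pC: "prob_space C" unfolding C_def by (rule prob_space_axioms)
  then interpret C: prob_space C .
  have spC: "space C = UNIV" by (simp add: C_def space_PiM)
  have bern: "emeasure (measure_pmf (bernoulli_pmf (1 / 2))) {b} = ennreal (1 / 2)" for b
    by (cases b) (simp_all add: emeasure_pmf_single)
  have *: "\<exists>r B. f -` Q2_ball c k \<inter> space P = {r} \<times> B \<and> r \<in> dyadic_unit \<and> B \<in> sets C \<and> emeasure C B = ennreal ((1 / 2) ^ k)" for c k
  proof -
    define r where "r = frac2 c"
    have r: "r \<in> dyadic_unit" "abs2 (c - of_rat r) \<le> 1" unfolding r_def by (rule frac2)+
    have r': "s = r" if "s \<in> dyadic_unit" "abs2 (c - of_rat s) \<le> 1" for s
      using frac2_eqI[OF that] by (simp add: r_def)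
    obtain v where v': "\<forall>w. Z2_of_digits w \<in> Q2_ball (c - of_rat r) k \<longleftrightarrow> (\<forall>i<k. w i = v i)"
      using Z2_of_digits_ball[OF r(2), of k] by (rule exE)
    have v: "Z2_of_digits w \<in> Q2_ball (c - of_rat r) k \<longleftrightarrow> (\<forall>i<k. w i = v i)" for w
      by (rule v'[rule_format])
    define B where "B = {w \<in> space C. \<forall>i\<in>{..<k}. w i \<in> {v i}}"
    have "emeasure C B = (\<Prod>i\<in>{..<k}. emeasure (measure_pmf (bernoulli_pmf (1 / 2))) {v i})"
      unfolding B_def C_def by (rule emeasure_PiM_Collect) auto
    also have "\<dots> = ennreal (1 / 2) ^ k" by (simp only: bern prod_constant card_lessThan)
    also have "\<dots> = ennreal ((1 / 2) ^ k)" by (rule ennreal_power) simp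
    finally have eB: "emeasure C B = ennreal ((1 / 2) ^ k)" .
    have B: "B \<in> sets C" 
    proof (rule ccontr)
      assume "B \<notin> sets C"
      then have "emeasure C B = 0" by (rule emeasure_notin_sets)
      with eB show False by simp
    qed
    have "(s, w) \<in> f -` Q2_ball c k \<inter> space P \<longleftrightarrow> s = r \<and> w \<in> B" for s w
    proof
      assume "(s, w) \<in> f -` Q2_ball c k \<inter> space P"
      then have s: "s \<in> dyadic_unit" and 1: "abs2 (of_rat s + Z2_of_digits w - c) \<le> (1 / 2) ^ k"
        by (auto simp: P_def space_pair_measure f_def Q2_ball_def)
      have "(1 / 2 :: real) ^ k \<le> 1" by (simp add: power_le_one)
      then have "abs2 (of_rat s + Z2_of_digits w - c) \<le> 1" using 1 by linarith
      moreover have "abs2 (Z2_of_digits w) \<le> 1" using Z2_of_digits_approx[of w 0] by (simp add: digit_sum_def)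
      moreover have "c - of_rat s = Z2_of_digits w - (of_rat s + Z2_of_digits w - c)" by simp
      ultimately have "abs2 (c - of_rat s) \<le> 1" using abs2_diff[of "Z2_of_digits w" "of_rat s + Z2_of_digits w - c"] by simp
      then have sr: "s = r" using r' s by blast
      have "of_rat s + Z2_of_digits w - c = Z2_of_digits w - (c - of_rat s)" by simp
      then have "Z2_of_digits w \<in> Q2_ball (c - of_rat r) k" using 1 sr by (simp only: Q2_ball_def mem_Collect_eq)
      then show "s = r \<and> w \<in> B" using sr v by (auto simp: B_def spC)
    next
      assume s: "s = r \<and> w \<in> B"
      then have "Z2_of_digits w \<in> Q2_ball (c - of_rat r) k" using v by (auto simp: B_def)
      moreover have "of_rat r + Z2_of_digits w - c = Z2_of_digits w - (c - of_rat r)" by simp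
      ultimately have "abs2 (of_rat r + Z2_of_digits w - c) \<le> (1 / 2) ^ k" by (simp only: Q2_ball_def mem_Collect_eq)
      then show "(s, w) \<in> f -` Q2_ball c k \<inter> space P"
        using s r by (auto simp: P_def space_pair_measure f_def Q2_ball_def spC)
    qed
    then have "f -` Q2_ball c k \<inter> space P = {r} \<times> B" by auto
    then show ?thesis using r(1) B eB by blast
  qed
  have f: "f \<in> measurable P borel"
  proof (rule borel_measurable_Q2I)
    fix c k
    obtain r B where rB: "f -` Q2_ball c k \<inter> space P = {r} \<times> B" "r \<in> dyadic_unit" "B \<in> sets C"
      using *[of c k] by (elim exE conjE)
    have "{r} \<times> B \<in> sets P" unfolding P_def using rB by (intro pair_measureI) auto
    then show "f -` Q2_ball c k \<inter> space P \<in> sets P" by (simp only: rB)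
  qed
  have "normalized_haar (distr P borel f)"
  proof (rule normalized_haarI)
    fix c k
    obtain r B where rB: "f -` Q2_ball c k \<inter> space P = {r} \<times> B" "r \<in> dyadic_unit" "B \<in> sets C"
      "emeasure C B = ennreal ((1 / 2) ^ k)"
      using *[of c k] by (elim exE conjE)
    have "emeasure (distr P borel f) (Q2_ball c k) = emeasure P ({r} \<times> B)"
      by (simp only: emeasure_distr[OF f Q2_ball_measurable] rB(1))
    also have "\<dots> = emeasure (count_space dyadic_unit) {r} * emeasure C B"
      unfolding P_def using rB by (intro C.emeasure_pair_measure_Times) auto
    also have "\<dots> = ennreal ((1 / 2) ^ k)" using rB by simp
    finally show "emeasure (distr P borel f) (Q2_ball c k) = ennreal ((1 / 2) ^ k)" .
  qed simp
  then show ?thesis by blast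
qed

lemma normalized_haar_haar: "normalized_haar haar"
proof -
  obtain \<mu> where h: "normalized_haar \<mu>" using normalized_haar_exists by blast
  show ?thesis unfolding haar_def proof (rule theI)
    show "normalized_haar \<mu>" by (rule h)
    show "\<nu> = \<mu>" if "normalized_haar \<nu>" for \<nu> by (rule normalized_haar_unique[OF that h])
  qed
qed

lemma sets_haar [measurable_cong, simp]: "sets haar = sets borel"
  using normalized_haar_haar unfolding normalized_haar_def by blast

lemma emeasure_haar_ball: "emeasure haar (Q2_ball c k) = ennreal ((1 / 2) ^ k)"
  by (rule normalized_haar_ball[OF normalized_haar_haar])

lemma sigma_finite_haar: "sigma_finite_measure haar"
proof
  have "Q2_basis \<subseteq> sets haar" using Q2_basis_ball by fastforce
  moreover have "\<Union> Q2_basis = space haar"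
    using Q2_ball_in_basis Q2_ball_center sets_eq_imp_space_eq[OF sets_haar] unfolding space_borel by blast
  moreover have "\<forall>a\<in>Q2_basis. emeasure haar a \<noteq> \<infinity>"
    using Q2_basis_ball emeasure_haar_ball by (metis ennreal_neq_top infinity_ennreal_def)
  ultimately show "\<exists>A. countable A \<and> A \<subseteq> sets haar \<and> \<Union> A = space haar \<and> (\<forall>a\<in>A. emeasure haar a \<noteq> \<infinity>)"
    using countable_Q2_basis by blast
qed

text \<open>Points of \<open>\<rat>\<^sub>2\<^sup>n\<close> are the extensional functions on \<open>{1..n}\<close>, the points of the
  product space \<open>Q2n n\<close>; only the coordinates in \<open>{1..n}\<close> matter.\<close>

definition Q2n :: "nat \<Rightarrow> (nat \<Rightarrow> Q2) measure" where
  "Q2n n = Pi\<^sub>M {1..n} (\<lambda>_. haar)"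

definition vnorm :: "nat \<Rightarrow> (nat \<Rightarrow> Q2) \<Rightarrow> real" where
  "vnorm n x = Max ((\<lambda>\<nu>. abs2 (x \<nu>)) ` {1..n})"

definition vdot :: "nat \<Rightarrow> (nat \<Rightarrow> Q2) \<Rightarrow> (nat \<Rightarrow> Q2) \<Rightarrow> Q2" where
  "vdot n \<xi> x = (\<Sum>\<nu>=1..n. \<xi> \<nu> * x \<nu>)"

definition chi2 :: "Q2 \<Rightarrow> complex" where
  "chi2 t = exp (2 * of_real pi * \<i> * of_rat (frac2 t))"

definition Omega :: "real \<Rightarrow> real" where
  "Omega t = (if 0 \<le> t \<and> t \<le> 1 then 1 else 0)"

definition I2 :: "Q2 set" where
  "I2 = {2 powi (- int \<gamma>) * (\<Sum>i<\<gamma>. d i * 2 ^ i) | \<gamma> d. \<forall>i. d i \<in> {0, 1}}"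

definition I2n :: "nat \<Rightarrow> (nat \<Rightarrow> Q2) set" where
  "I2n n = (\<Pi>\<^sub>E \<nu>\<in>{1..n}. I2)"

definition kvec :: "nat set \<Rightarrow> nat \<Rightarrow> Q2" where
  "kvec e \<nu> = (if \<nu> \<in> e then 1 else 0)"

definition Psi :: "nat \<Rightarrow> nat set \<Rightarrow> int \<Rightarrow> (nat \<Rightarrow> Q2) \<Rightarrow> (nat \<Rightarrow> Q2) \<Rightarrow> complex" where
  "Psi n e j a x =
     of_real (2 powr (- (real n * real_of_int j / 2))) *
     chi2 (2 powi (-1) * vdot n (kvec e) (\<lambda>\<nu>. 2 powi j * x \<nu> - a \<nu>)) *
     of_real (Omega (vnorm n (\<lambda>\<nu>. 2 powi j * x \<nu> - a \<nu>)))"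

text \<open>The elements of \<open>\<L>\<^sup>2(M)\<close> are represented by functions, functions equal almost everywhere
  being identified through the seminorm \<open>L2_norm M\<close>. An orthonormal basis is an orthonormal family
  whose (finite) linear span is dense.\<close>

definition L2_space :: "'a measure \<Rightarrow> ('a \<Rightarrow> complex) set" where
  "L2_space M = {f \<in> borel_measurable M. integrable M (\<lambda>x. (cmod (f x))\<^sup>2)}"

definition L2_inner :: "'a measure \<Rightarrow> ('a \<Rightarrow> complex) \<Rightarrow> ('a \<Rightarrow> complex) \<Rightarrow> complex" where
  "L2_inner M f g = (LINT x|M. f x * cnj (g x))"

definition L2_norm :: "'a measure \<Rightarrow> ('a \<Rightarrow> complex) \<Rightarrow> real" where
  "L2_norm M f = sqrt (LINT x|M. (cmod (f x))\<^sup>2)"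

definition orthonormal_basis_L2 :: "'a measure \<Rightarrow> 'i set \<Rightarrow> ('i \<Rightarrow> 'a \<Rightarrow> complex) \<Rightarrow> bool" where
  "orthonormal_basis_L2 M I \<phi> \<longleftrightarrow>
     (\<forall>i\<in>I. \<phi> i \<in> L2_space M) \<and>
     (\<forall>i\<in>I. \<forall>k\<in>I. L2_inner M (\<phi> i) (\<phi> k) = (if i = k then 1 else 0)) \<and>
     (\<forall>f\<in>L2_space M. \<forall>\<epsilon>>0. \<exists>F c. finite F \<and> F \<subseteq> I \<and>
        L2_norm M (\<lambda>x. f x - (\<Sum>i\<in>F. c i * \<phi> i x)) < \<epsilon>)"

end

theory Submission
  imports Defs
begin

text \<open>Substituting \<open>y = 2\<^sup>j x - a\<close>, the factor \<open>\<chi>\<^sub>2 (y\<^sub>\<nu> / 2)\<close> is the sign \<open>\<plusminus>1\<close> that separates the two halves of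
  \<open>\<int>\<^sub>2\<close>. So \<open>\<Psi>\<close> is a tensor product of normalized one-dimensional factors: the indicator of a ball in the
  coordinates outside \<open>e\<close> and the Haar wavelet (indicator of one half minus indicator of the other) in those
  in \<open>e\<close>. A wavelet has integral 0 and every coarser indicator or wavelet is constant on its support, which gives
  orthogonality by Fubini.

  For density, expanding \<open>\<Prod> (1 + wavelet)\<close> writes the indicator of a cube as \<open>2\<^sup>-\<^sup>n\<close> times the indicator of
  the next larger cube plus a linear combination of the \<open>\<Psi>\<close>. After \<open>k\<close> steps the remaining indicator has
  norm proportional to \<open>2\<close> to the power \<open>- n k / 2\<close>, hence indicators of cubes lie in the closed span. Cubes
  are stable under intersection and generate the Borel sets, so a Dynkin argument and approximation by simple
  functions finish the proof.\<close>

subsection \<open>Dyadic balls and the additive character\<close>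

lemma abs2_2_powi: "abs2 (2 powi j) = 2 powi (- j)"
  by (cases j rule: int_cases2)
    (simp_all add: power_int_minus abs2_inverse abs2_divide abs2_2_power power_one_over inverse_eq_divide)

text \<open>An element of Z_2 is congruent to 0 or 1 modulo 2; for \<open>2 * y\<close> these
  residues give the two cosets of Z_2 in (1/2) Z_2. This is the splitting of a ball into
  halves.\<close>

lemma abs2_half_cases: "abs2 (2 * y) \<le> 1 \<longleftrightarrow> abs2 y \<le> 1 \<or> abs2 (y - 1/2) \<le> 1"
proof
  assume "abs2 (2 * y) \<le> 1"
  then obtain N :: nat where N: "N < 2 ^ 1" "abs2 (2 * y - of_nat N) \<le> (1/2) ^ 1"
    using Z2_nat_approx by blast
  have "2 * y - of_nat N = 2 * (y - of_nat N / 2)" by simp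
  then have "abs2 (y - of_nat N / 2) \<le> 1" using N(2) by (simp only: abs2_mult abs2_2) simp
  moreover have "N = 0 \<or> N = 1" using N(1) by auto
  ultimately show "abs2 y \<le> 1 \<or> abs2 (y - 1/2) \<le> 1" by auto
next
  have "abs2 (2 * (y - 1/2) + 1) \<le> 1" if "abs2 (y - 1/2) \<le> 1"
    using abs2_add[of "2 * (y - 1/2)" 1] that by (simp add: abs2_mult abs2_2 del: right_diff_distrib_numeral)
  moreover have "abs2 (2 * y) \<le> 1" if "abs2 y \<le> 1" using that by (simp add: abs2_mult abs2_2)
  ultimately show "abs2 y \<le> 1 \<or> abs2 (y - 1/2) \<le> 1 \<Longrightarrow> abs2 (2 * y) \<le> 1"
    by (auto simp: algebra_simps)
qed

text \<open>Otherwise 1/2, of absolute value 2, would be a difference of 2-adic integers.\<close>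

lemma abs2_half_disjoint: "\<not> (abs2 y \<le> 1 \<and> abs2 (y - 1/2) \<le> 1)"
proof
  assume "abs2 y \<le> 1 \<and> abs2 (y - 1/2) \<le> 1"
  then have "abs2 (y - (y - 1/2)) \<le> 1" using abs2_diff[of y "y - 1/2"] by (auto simp del: diff_diff_eq2)
  then show False by (simp add: abs2_divide abs2_2)
qed

section \<open>The additive character\<close>

text \<open>\<open>frac2\<close> insists on a representative in [0, 1). Here any dyadic rational
  will do: reducing \<open>m\<close> modulo \<open>2 ^ g\<close> changes it by an integer, which the
  period of \<open>exp\<close> absorbs.\<close>

lemma chi2_eqI:
  fixes m :: int
  assumes "abs2 (t - of_rat (of_int m / 2 ^ g)) \<le> 1"
  shows "chi2 t = exp (2 * of_real pi * \<i> * of_rat (of_int m / 2 ^ g))"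
proof -
  define q where "q = m div 2 ^ g"
  define N where "N = nat (m mod 2 ^ g)"
  have iN: "int N = m mod 2 ^ g" by (simp add: N_def)
  then have "N < 2 ^ g" by (metis of_nat_less_iff of_nat_numeral of_nat_power pos_mod_bound zero_less_numeral zero_less_power)
  then have d: "of_nat N / 2 ^ g \<in> dyadic_unit" unfolding dyadic_unit_def by blast
  have "m = q * 2 ^ g + int N" unfolding q_def iN by (rule div_mult_mod_eq[symmetric])
  then have eq: "(of_int m / 2 ^ g :: rat) = of_int q + of_nat N / 2 ^ g"
    by (simp add: field_simps)
  have t: "t - of_rat (of_nat N / 2 ^ g) = (t - of_rat (of_int m / 2 ^ g)) + of_int q"
    unfolding eq of_rat_add by simp
  have "abs2 (t - of_rat (of_nat N / 2 ^ g)) \<le> 1"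
    unfolding t by (rule order_trans[OF abs2_add max.boundedI[OF assms abs2_of_int_le1]])
  then have "frac2 t = of_nat N / 2 ^ g" by (rule frac2_eqI[OF d])
  then have "2 * of_real pi * \<i> * of_rat (of_int m / 2 ^ g)
      = 2 * of_real pi * \<i> * of_rat (frac2 t) + \<i> * (of_int q * (of_real pi * 2))"
    unfolding eq of_rat_add by (simp add: algebra_simps)
  then show ?thesis unfolding chi2_def by (simp only: exp_plus_2pin)
qed

lemma dyadic_unitE:
  assumes "r \<in> dyadic_unit" obtains m :: int and g where "r = of_int m / 2 ^ g"
  using assms unfolding dyadic_unit_def by (auto intro: that[of "int _"])

text \<open>The sum of two fractional parts may reach 1 or more, so it need not be
  \<open>frac2 (s + t)\<close>; \<open>chi2_eqI\<close> accepts it all the same.\<close>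

lemma chi2_add: "chi2 (s + t) = chi2 s * chi2 t"
proof -
  obtain m :: int and g where m: "frac2 s = of_int m / 2 ^ g" using dyadic_unitE frac2(1) by blast
  obtain l :: int and h where l: "frac2 t = of_int l / 2 ^ h" using dyadic_unitE frac2(1) by blast
  have eq: "frac2 s + frac2 t = of_int (m * 2 ^ h + l * 2 ^ g) / 2 ^ (g + h)"
    by (simp add: m l field_simps power_add)
  have "abs2 (s + t - of_rat (frac2 s + frac2 t)) \<le> 1"
    using abs2_add[of "s - of_rat (frac2 s)" "t - of_rat (frac2 t)"] frac2(2)[of s] frac2(2)[of t]
    by (simp add: of_rat_add algebra_simps)
  then have "chi2 (s + t) = exp (2 * of_real pi * \<i> * of_rat (frac2 s + frac2 t))"
    unfolding eq by (rule chi2_eqI)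
  then show ?thesis by (simp add: chi2_def of_rat_add distrib_left exp_add)
qed

lemma chi2_Z2: "abs2 t \<le> 1 \<Longrightarrow> chi2 t = 1"
  using chi2_eqI[of t 0 0] by simp

lemma chi2_half_Z2: "abs2 (t - 1/2) \<le> 1 \<Longrightarrow> chi2 t = - 1"
  using chi2_eqI[of t 1 1] by (simp add: of_rat_divide mult.commute)

lemma chi2_sum: "finite A \<Longrightarrow> chi2 (sum f A) = (\<Prod>i\<in>A. chi2 (f i))"
  by (induction A rule: finite_induct) (simp_all add: chi2_add chi2_Z2)

section \<open>Representatives of Q_2 modulo Z_2\<close>

text \<open>The digits \<open>d\<close> are the binary digits of the numerator. Existence and
  uniqueness of representatives in \<open>I2\<close> thereby reduce to the properties of
  \<open>frac2\<close>.\<close>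

lemma I2_eq_dyadic_unit: "I2 = of_rat ` dyadic_unit"
proof (intro equalityI subsetI)
  fix x assume "x \<in> I2"
  then obtain \<gamma> and d :: "nat \<Rightarrow> Q2"
    where x: "x = 2 powi (- int \<gamma>) * (\<Sum>i<\<gamma>. d i * 2 ^ i)" and d: "\<And>i. d i \<in> {0, 1}"
    unfolding I2_def by blast
  define w where "w i \<longleftrightarrow> d i = 1" for i
  have "d i * 2 ^ i = of_nat (if w i then 2 ^ i else 0)" for i using d[of i] by (auto simp: w_def)
  then have "x = of_nat (digit_sum w \<gamma>) / 2 ^ \<gamma>"
    by (simp add: x digit_sum_def power_int_minus field_simps)
  then have "x = of_rat (of_nat (digit_sum w \<gamma>) / 2 ^ \<gamma>)" by (simp add: of_rat_divide of_rat_power)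
  moreover have "of_nat (digit_sum w \<gamma>) / 2 ^ \<gamma> \<in> dyadic_unit"
    using digit_sum_less unfolding dyadic_unit_def by blast
  ultimately show "x \<in> of_rat ` dyadic_unit" by blast
next
  fix x :: Q2 assume "x \<in> of_rat ` dyadic_unit"
  then obtain m \<gamma> :: nat where x: "x = of_rat (of_nat m / 2 ^ \<gamma>)" and m: "m < 2 ^ \<gamma>"
    unfolding dyadic_unit_def by blast
  obtain w where w: "digit_sum w \<gamma> = m" using digit_sum_surj[OF m] by blast
  define d :: "nat \<Rightarrow> Q2" where "d i = (if w i then 1 else 0)" for i
  have "(\<Sum>i<\<gamma>. d i * 2 ^ i) = of_nat m"
    unfolding w[symmetric] digit_sum_def d_def of_nat_sum by (intro sum.cong) auto
  then have "x = 2 powi (- int \<gamma>) * (\<Sum>i<\<gamma>. d i * 2 ^ i)"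
    by (simp add: x of_rat_divide of_rat_power power_int_minus field_simps)
  moreover have "\<forall>i. d i \<in> {0, 1}" by (simp add: d_def)
  ultimately show "x \<in> I2" unfolding I2_def by blast
qed

lemma I2_approx: "\<exists>a\<in>I2. abs2 (t - a) \<le> 1"
  unfolding I2_eq_dyadic_unit using frac2 by blast

text \<open>Both are fractional parts of \<open>a\<close>.\<close>

lemma I2_unique:
  assumes "a \<in> I2" "b \<in> I2" "abs2 (a - b) \<le> 1"
  shows "a = b"
proof -
  obtain r s where rs: "a = of_rat r" "r \<in> dyadic_unit" "b = of_rat s" "s \<in> dyadic_unit"
    using assms(1,2) unfolding I2_eq_dyadic_unit by blast
  have "frac2 a = r" using rs by (intro frac2_eqI) simp_all
  moreover have "frac2 a = s" using rs assms(3) by (intro frac2_eqI) simp_all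
  ultimately show ?thesis using rs by simp
qed

lemma countable_I2n: "countable (I2n n)"
  unfolding I2n_def I2_eq_dyadic_unit by (intro countable_PiE countable_image) auto

lemma I2n_approx: obtains a where "a \<in> I2n n" "\<And>\<nu>. \<nu> \<in> {1..n} \<Longrightarrow> abs2 (x \<nu> - a \<nu>) \<le> 1"
proof -
  obtain f where f: "\<And>t. f t \<in> I2" "\<And>t. abs2 (t - f t) \<le> 1" using I2_approx by metis
  show ?thesis
    by (rule that[of "\<lambda>\<nu>\<in>{1..n}. f (x \<nu>)"]) (simp_all add: I2n_def f)
qed

section \<open>Dyadic balls and their measure\<close>

text \<open>This is the ball of radius \<open>2 powi j\<close> about
  \<open>2 powi (- j) * a\<close>, written in the scale and translation parameters of
  \<open>Psi\<close>. Larger \<open>j\<close> means a larger ball, and only the class of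
  \<open>a\<close> modulo Z_2 matters.\<close>

definition dball :: "int \<Rightarrow> Q2 \<Rightarrow> Q2 set" where
  "dball j a = {x. abs2 (2 powi j * x - a) \<le> 1}"

lemma dball_cong: "abs2 (a - b) \<le> 1 \<Longrightarrow> dball j a = dball j b"
  unfolding dball_def by (metis abs2_diff_trans abs2_minus_commute)

lemma dball_split: "dball (j + 1) (2 * a) = dball j a \<union> dball j (a + 1/2)"
  "dball j a \<inter> dball j (a + 1/2) = {}"
proof -
  have "2 powi (j + 1) * x - 2 * a = 2 * (2 powi j * x - a)" for x :: Q2 by (simp add: power_int_add)
  then have "x \<in> dball (j + 1) (2 * a) \<longleftrightarrow> abs2 (2 powi j * x - a) \<le> 1 \<or> abs2 (2 powi j * x - a - 1/2) \<le> 1" for x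
    by (simp only: dball_def mem_Collect_eq abs2_half_cases)
  then show "dball (j + 1) (2 * a) = dball j a \<union> dball j (a + 1/2)"
    by (auto simp: dball_def diff_diff_eq)
  show "dball j a \<inter> dball j (a + 1/2) = {}"
    using abs2_half_disjoint by (auto simp: dball_def simp flip: diff_diff_eq)
qed

text \<open>Passing from scale \<open>j\<close> to the coarser scale \<open>i\<close> multiplies
  differences by \<open>2 powi (i - j)\<close>, a 2-adic integer, and the ultrametric inequality
  does the rest. Two balls are therefore disjoint or nested.\<close>

lemma dball_nested:
  assumes "j \<le> i" "x \<in> dball j a" "x \<in> dball i b"
  shows "dball j a \<subseteq> dball i b"
proof
  fix y assume "y \<in> dball j a"
  then have "abs2 (2 powi j * y - 2 powi j * x) \<le> 1"
    using assms(2) abs2_diff_trans[of "2 powi j * y" a 1 "2 powi j * x"]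
    by (simp add: dball_def abs2_minus_commute)
  moreover have "2 powi i * y - 2 powi i * x = 2 powi (i - j) * (2 powi j * y - 2 powi j * x)"
    by (simp add: power_int_diff field_simps)
  moreover have "2 powi (- (i - j)) \<le> (2::real) powi 0"
    using assms(1) by (intro power_int_increasing) auto
  ultimately have "abs2 (2 powi i * y - 2 powi i * x) \<le> 1 * 1"
    by (simp only: abs2_mult abs2_2_powi) (intro mult_mono, auto)
  then show "y \<in> dball i b"
    using assms(3) abs2_diff_trans[of "2 powi i * y" "2 powi i * x" 1 b] by (simp add: dball_def)
qed

lemma dball_eq_Q2_ball: "dball (- int k) a = Q2_ball (2 ^ k * a) k"
proof -
  have "2 powi (- int k) * x - a = (x - 2 ^ k * a) / 2 ^ k" for x
    by (simp add: power_int_minus inverse_eq_divide diff_divide_distrib)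
  then have "abs2 (2 powi (- int k) * x - a) = abs2 (x - 2 ^ k * a) / (1 / 2) ^ k" for x
    by (simp only: abs2_divide abs2_2_power)
  then show ?thesis by (simp add: dball_def Q2_ball_def del: power_int_of_nat power_int_minus_left)
qed

text \<open>Radii up to 1 are the case of \<open>Q2_ball\<close>; larger balls are assembled from
  two halves by induction on \<open>j\<close>. Measurability is carried along because adding the
  measures of the halves requires it.\<close>

lemma dball_haar: "dball j a \<in> sets borel \<and> emeasure haar (dball j a) = ennreal (2 powi j)"
proof (cases "j \<le> 0")
  case True
  then obtain k where "j = - int k" using nonpos_int_cases by blast
  then show ?thesis by (simp add: dball_eq_Q2_ball emeasure_haar_ball power_int_minus power_one_over inverse_eq_divide)
next
  case False
  then have "0 \<le> j" by simp
  then show ?thesis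
  proof (induction j arbitrary: a rule: int_ge_induct)
    case base
    show ?case using emeasure_haar_ball[of a 0] dball_eq_Q2_ball[of 0 a] by simp
  next
    case (step i)
    have s: "dball (i + 1) a = dball i (a / 2) \<union> dball i (a / 2 + 1 / 2)"
      using dball_split(1)[of i "a / 2"] by simp
    have "emeasure haar (dball (i + 1) a) = emeasure haar (dball i (a / 2)) + emeasure haar (dball i (a / 2 + 1 / 2))"
      unfolding s using step.IH dball_split(2)[of i "a / 2"] by (intro plus_emeasure[symmetric]) auto
    also have "\<dots> = ennreal (2 powi (i + 1))"
      using step.IH by (simp add: power_int_add flip: ennreal_plus)
    finally show ?case using s step.IH by auto
  qed
qed

lemma dball_measurable [measurable]: "dball j a \<in> sets borel"
  using dball_haar by blast

lemma emeasure_dball: "emeasure haar (dball j a) = ennreal (2 powi j)"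
  using dball_haar by blast

lemma measure_dball: "measure haar (dball j a) = 2 powi j"
  by (simp add: measure_def emeasure_dball)

subsection \<open>Orthonormality\<close>

text \<open>The flag \<open>b\<close> will say whether the coordinate lies in \<open>e\<close>:
  \<open>True\<close> is the wavelet, \<open>False\<close> the indicator. Either one lives on
  \<open>dball j a\<close> and has the indicator of that ball as its square.\<close>

definition haar_wave :: "bool \<Rightarrow> int \<Rightarrow> Q2 \<Rightarrow> Q2 \<Rightarrow> real" where
  "haar_wave b j a x =
     (if b then indicator (dball (j - 1) (a / 2)) x - indicator (dball (j - 1) (a / 2 + 1 / 2)) x
      else indicator (dball j a) x)"

lemma dball_halves: "dball j a = dball (j - 1) (a / 2) \<union> dball (j - 1) (a / 2 + 1 / 2)"
  "dball (j - 1) (a / 2) \<inter> dball (j - 1) (a / 2 + 1 / 2) = {}"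
  using dball_split[of "j - 1" "a / 2"] by simp_all

lemma haar_wave_outside: "x \<notin> dball j a \<Longrightarrow> haar_wave b j a x = 0"
  using dball_halves[of j a] by (auto simp: haar_wave_def)

lemma haar_wave_square: "haar_wave b j a x * haar_wave b j a x = indicator (dball j a) x"
  using dball_halves[of j a] by (auto simp: haar_wave_def indicator_def)

lemma haar_wave_measurable [measurable]: "haar_wave b j a \<in> borel_measurable borel"
  unfolding haar_wave_def by measurable

lemma integrable_dball: "integrable haar (indicator (dball j a) :: Q2 \<Rightarrow> real)"
  by (rule integrable_real_indicator) (simp_all add: emeasure_dball)

lemma integrable_haar_wave: "integrable haar (haar_wave b j a)"
  using integrable_dball by (cases b) (simp_all add: haar_wave_def[abs_def])

lemma abs_haar_wave_le: "\<bar>haar_wave b j a x\<bar> \<le> 1"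
  by (simp add: haar_wave_def indicator_def)

lemma integrable_haar_wave_mult: "integrable haar (\<lambda>x. haar_wave b j a x * haar_wave b' j' a' x)"
proof (rule Bochner_Integration.integrable_bound[OF integrable_haar_wave[of b j a]])
  show "AE x in haar. norm (haar_wave b j a x * haar_wave b' j' a' x) \<le> norm (haar_wave b j a x)"
    using abs_haar_wave_le by (simp add: abs_mult mult_left_le)
qed measurable

text \<open>The coarser ball either misses the support of the wavelet or contains it. In the second
  case the integral is that of the wavelet, whose two halves have equal measure.\<close>

lemma integral_haar_wave_dball:
  assumes "j \<le> i"
  shows "(\<integral>x. haar_wave True j a x * indicator (dball i b) x \<partial>haar) = 0"
proof (cases "dball j a \<inter> dball i b = {}")
  case True
  then have "haar_wave True j a x * indicator (dball i b) x = 0" for x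
    using haar_wave_outside[of x j a] by (cases "x \<in> dball j a") (auto simp: indicator_def)
  then show ?thesis by (simp only: integral_zero)
next
  case False
  then have "dball j a \<subseteq> dball i b" using dball_nested[OF assms] by blast
  then have "haar_wave True j a x * indicator (dball i b) x = haar_wave True j a x" for x
    using haar_wave_outside[of x j a True] by (cases "x \<in> dball j a") (auto simp: indicator_def)
  then have "(\<integral>x. haar_wave True j a x * indicator (dball i b) x \<partial>haar) = (\<integral>x. haar_wave True j a x \<partial>haar)"
    by (simp only:)
  then show ?thesis
    using integrable_dball by (simp add: haar_wave_def measure_dball sets_eq_imp_space_eq[OF sets_haar])
qed

text \<open>The second factor is a combination of indicators of balls at least as coarse as
  \<open>dball j a\<close>, and the wavelet integrates to 0 against each of them.\<close>

lemma haar_wave_orthogonal: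
  assumes "j < j' \<or> j = j' \<and> \<not> b'"
  shows "(\<integral>x. haar_wave True j a x * haar_wave b' j' a' x \<partial>haar) = 0"
proof (cases b')
  case True
  have "integrable haar (\<lambda>x. haar_wave True j a x * indicator (dball i c) x)" for i c
    using integrable_haar_wave_mult[of True j a False i c] by (simp add: haar_wave_def[of False])
  \<comment> \<open>The halves of the second wavelet have scale \<open>j' - 1\<close>, so the strict
    inequality is what keeps them no finer than scale \<open>j\<close>.\<close>
  moreover have "j \<le> j' - 1" using assms True by simp
  ultimately show ?thesis
    using True by (simp add: haar_wave_def[of True j'] right_diff_distrib integral_haar_wave_dball)
next
  case False
  moreover have "j \<le> j'" using assms by auto
  ultimately show ?thesis by (simp add: haar_wave_def[of False] integral_haar_wave_dball)
qed

lemma integral_haar_wave_square: "(\<integral>x. haar_wave b j a x * haar_wave b j a x \<partial>haar) = 2 powi j"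
  by (simp add: haar_wave_square measure_dball sets_eq_imp_space_eq[OF sets_haar])

text \<open>Moving \<open>a\<close> by a 2-adic integer fixes the ball, but an odd shift exchanges
  its halves, so the wavelet changes sign. This allows arbitrary translations to be replaced by
  representatives in \<open>I2\<close>.\<close>

lemma haar_wave_shift:
  assumes "abs2 (a - a') \<le> 1"
  shows "\<exists>s::real. \<forall>x. haar_wave b j a x = s * haar_wave b j a' x"
proof (cases b)
  case False
  then show ?thesis using dball_cong[OF assms] by (intro exI[of _ 1]) (simp add: haar_wave_def)
next
  case True
  have "abs2 (2 * (a / 2 - a' / 2)) \<le> 1" using assms by (simp add: right_diff_distrib)
  then have "abs2 (a / 2 - a' / 2) \<le> 1 \<or> abs2 (a / 2 - a' / 2 - 1 / 2) \<le> 1"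
    by (simp only: abs2_half_cases)
  then show ?thesis
  proof
    assume *: "abs2 (a / 2 - a' / 2) \<le> 1"
    have "dball (j - 1) (a / 2) = dball (j - 1) (a' / 2)" using * by (rule dball_cong)
    moreover have "dball (j - 1) (a / 2 + 1 / 2) = dball (j - 1) (a' / 2 + 1 / 2)"
      by (rule dball_cong) (use * in simp)
    ultimately show ?thesis using True by (intro exI[of _ 1]) (simp add: haar_wave_def)
  next
    assume *: "abs2 (a / 2 - a' / 2 - 1 / 2) \<le> 1"
    have "dball (j - 1) (a / 2) = dball (j - 1) (a' / 2 + 1 / 2)"
      by (rule dball_cong) (use * in \<open>simp only: diff_diff_eq\<close>)
    moreover have "dball (j - 1) (a / 2 + 1 / 2) = dball (j - 1) (a' / 2)"
    proof (rule dball_cong)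
      \<comment> \<open>Two shifts by 1/2 add up to 1, which does not change the ball.\<close>
      have "a / 2 + 1 / 2 - a' / 2 = (a / 2 - a' / 2 - 1 / 2) + 1" by simp
      then show "abs2 (a / 2 + 1 / 2 - a' / 2) \<le> 1"
        using abs2_add[of "a / 2 - a' / 2 - 1 / 2" 1] * by (simp only:) simp
    qed
    ultimately show ?thesis using True by (intro exI[of _ "-1"]) (simp add: haar_wave_def)
  qed
qed

section \<open>Tensor products of one-dimensional factors\<close>

text \<open>Up to the factor 2 to the power \<open>- n j / 2\<close> this is \<open>Psi\<close>, as
  a real function and for arbitrary \<open>a\<close>.\<close>

definition wave_prod :: "nat \<Rightarrow> nat set \<Rightarrow> int \<Rightarrow> (nat \<Rightarrow> Q2) \<Rightarrow> (nat \<Rightarrow> Q2) \<Rightarrow> real" where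
  "wave_prod n e j a x = (\<Prod>\<nu>=1..n. haar_wave (\<nu> \<in> e) j (a \<nu>) (x \<nu>))"

text \<open>With y = \<open>2 powi j * x - a\<close> in Z_2, the halves of the ball correspond to
  y/2 in Z_2, where the character is 1, and to y/2 in 1/2 + Z_2, where it is -1.\<close>

lemma chi2_haar_wave:
  assumes "x \<in> dball j a"
  shows "chi2 (2 powi (-1) * (kvec e \<nu> * (2 powi j * x - a))) = of_real (haar_wave (\<nu> \<in> e) j a x)"
proof (cases "\<nu> \<in> e")
  case False
  then show ?thesis using assms by (simp add: kvec_def haar_wave_def chi2_Z2)
next
  case True
  have half: "2 powi (j - 1) * x - a / 2 = (2 powi j * x - a) / 2"
    by (simp add: power_int_diff diff_divide_distrib)
  have half': "2 powi (j - 1) * x - (a / 2 + 1 / 2) = (2 powi j * x - a) / 2 - 1 / 2"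
    by (simp only: half flip: diff_diff_eq)
  have "x \<in> dball (j - 1) (a / 2) \<or> x \<in> dball (j - 1) (a / 2 + 1 / 2)"
    using assms dball_halves(1)[of j a] by blast
  then show ?thesis
  proof
    assume x: "x \<in> dball (j - 1) (a / 2)"
    then have "chi2 ((2 powi j * x - a) / 2) = 1"
      by (intro chi2_Z2) (simp only: dball_def mem_Collect_eq half)
    moreover have "x \<notin> dball (j - 1) (a / 2 + 1 / 2)" using x dball_halves(2) by blast
    ultimately show ?thesis using True x by (simp add: kvec_def haar_wave_def)
  next
    assume x: "x \<in> dball (j - 1) (a / 2 + 1 / 2)"
    then have "chi2 ((2 powi j * x - a) / 2) = - 1"
      by (intro chi2_half_Z2) (simp only: dball_def mem_Collect_eq half')
    moreover have "x \<notin> dball (j - 1) (a / 2)" using x dball_halves(2) by blast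
    ultimately show ?thesis using True x by (simp add: kvec_def haar_wave_def)
  qed
qed

text \<open>On the cube where all coordinates lie in their balls, \<open>Omega\<close> is 1 and the
  character of the sum is the product of the characters. Off the cube, both sides vanish.\<close>

lemma Psi_eq_wave_prod:
  assumes "n \<ge> 1"
  shows "Psi n e j a x = of_real (2 powr (- (real n * real_of_int j / 2)) * wave_prod n e j a x)"
proof (cases "\<forall>\<nu>\<in>{1..n}. x \<nu> \<in> dball j (a \<nu>)")
  case True
  have "vnorm n (\<lambda>\<nu>. 2 powi j * x \<nu> - a \<nu>) \<le> 1"
    unfolding vnorm_def using assms True by (subst Max_le_iff) (auto simp: dball_def)
  \<comment> \<open>\<open>Omega\<close> also demands a nonnegative argument. Comparison with
    coordinate 1, present because \<open>n \<ge> 1\<close>, provides it.\<close>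
  moreover have "vnorm n (\<lambda>\<nu>. 2 powi j * x \<nu> - a \<nu>) \<ge> abs2 (2 powi j * x 1 - a 1)"
    unfolding vnorm_def using assms by (intro Max_ge) auto
  then have "vnorm n (\<lambda>\<nu>. 2 powi j * x \<nu> - a \<nu>) \<ge> 0" using abs2_nonneg order_trans by blast
  moreover have "chi2 (2 powi (-1) * vdot n (kvec e) (\<lambda>\<nu>. 2 powi j * x \<nu> - a \<nu>)) = of_real (wave_prod n e j a x)"
    unfolding vdot_def sum_distrib_left wave_prod_def of_real_prod chi2_sum[OF finite_atLeastAtMost]
    using True by (intro prod.cong refl chi2_haar_wave) blast
  ultimately show ?thesis by (simp add: Psi_def Omega_def)
next
  case False
  then obtain \<nu> where v: "\<nu> \<in> {1..n}" "x \<nu> \<notin> dball j (a \<nu>)" by blast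
  have "abs2 (2 powi j * x \<nu> - a \<nu>) \<le> vnorm n (\<lambda>\<nu>. 2 powi j * x \<nu> - a \<nu>)"
    unfolding vnorm_def using v(1) by (intro Max_ge) auto
  moreover have "wave_prod n e j a x = 0"
    unfolding wave_prod_def using v haar_wave_outside by (intro prod_zero bexI[of _ \<nu>]) auto
  ultimately show ?thesis using v(2) by (simp add: Psi_def Omega_def dball_def)
qed

text \<open>Fubini: the product of two tensor products is the tensor product of the coordinatewise
  products.\<close>

lemma wave_prod_mult_integral:
  "integrable (Q2n n) (\<lambda>x. wave_prod n e j a x * wave_prod n e' j' a' x)"
  "(\<integral>x. wave_prod n e j a x * wave_prod n e' j' a' x \<partial>Q2n n) =
     (\<Prod>\<nu>=1..n. \<integral>t. haar_wave (\<nu> \<in> e) j (a \<nu>) t * haar_wave (\<nu> \<in> e') j' (a' \<nu>) t \<partial>haar)"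
proof -
  interpret haar: sigma_finite_measure haar by (rule sigma_finite_haar)
  interpret product_sigma_finite "\<lambda>_::nat. haar" ..
  show "integrable (Q2n n) (\<lambda>x. wave_prod n e j a x * wave_prod n e' j' a' x)"
    unfolding wave_prod_def Q2n_def prod.distrib[symmetric]
    by (intro product_integrable_prod integrable_haar_wave_mult) simp
  show "(\<integral>x. wave_prod n e j a x * wave_prod n e' j' a' x \<partial>Q2n n) =
     (\<Prod>\<nu>=1..n. \<integral>t. haar_wave (\<nu> \<in> e) j (a \<nu>) t * haar_wave (\<nu> \<in> e') j' (a' \<nu>) t \<partial>haar)"
    unfolding wave_prod_def Q2n_def prod.distrib[symmetric]
    by (intro product_integral_prod integrable_haar_wave_mult) simp
qed

lemma wave_prod_measurable [measurable]: "wave_prod n e j a \<in> borel_measurable (Q2n n)"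
  unfolding wave_prod_def Q2n_def by measurable

lemma wave_prod_norm: "(\<integral>x. (wave_prod n e j a x)\<^sup>2 \<partial>Q2n n) = (2 powi j) ^ n"
  by (simp add: power2_eq_square wave_prod_mult_integral(2) integral_haar_wave_square)

text \<open>One coordinate with vanishing integral suffices: any coordinate of \<open>e\<close> if
  the first function is strictly finer, and a coordinate of \<open>e\<close> outside
  \<open>e'\<close> at equal scales.\<close>

lemma wave_prod_orthogonal_aux:
  assumes "e \<subseteq> {1..n}" "e \<noteq> {}" "j < j' \<or> j = j' \<and> a = a' \<and> \<not> e \<subseteq> e'"
  shows "(\<integral>x. wave_prod n e j a x * wave_prod n e' j' a' x \<partial>Q2n n) = 0"
proof -
  obtain \<nu> where v: "\<nu> \<in> e" "j < j' \<or> j = j' \<and> \<not> \<nu> \<in> e'" using assms by blast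
  have "(\<integral>t. haar_wave (\<nu> \<in> e) j (a \<nu>) t * haar_wave (\<nu> \<in> e') j' (a' \<nu>) t \<partial>haar) = 0"
    using haar_wave_orthogonal[OF v(2)] v(1) by simp
  then show ?thesis unfolding wave_prod_mult_integral(2) using v(1) assms(1) by (intro prod_zero bexI[of _ \<nu>]) auto
qed

text \<open>If the scales differ, or only the sets \<open>e\<close> and \<open>e'\<close> do, the
  auxiliary lemma applies in one of the two orders. If the scales agree and the translations differ,
  distinct representatives in some coordinate give disjoint balls there.\<close>

lemma wave_prod_orthogonal:
  assumes "e \<subseteq> {1..n}" "e \<noteq> {}" "a \<in> I2n n" "e' \<subseteq> {1..n}" "e' \<noteq> {}" "a' \<in> I2n n"
    and "(e, j, a) \<noteq> (e', j', a')"
  shows "(\<integral>x. wave_prod n e j a x * wave_prod n e' j' a' x \<partial>Q2n n) = 0"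
proof -
  have sym: "(\<integral>x. wave_prod n e j a x * wave_prod n e' j' a' x \<partial>Q2n n) =
    (\<integral>x. wave_prod n e' j' a' x * wave_prod n e j a x \<partial>Q2n n)" by (simp only: mult.commute)
  consider "j < j'" | "j' < j" | "j = j'" "a \<noteq> a'" | "j = j'" "a = a'" "e \<noteq> e'"
    using assms(7) by fastforce
  then show ?thesis
  proof cases
    case 1
    then show ?thesis using assms wave_prod_orthogonal_aux by blast
  next
    case 2
    then show ?thesis unfolding sym using assms wave_prod_orthogonal_aux by blast
  next
    case 3
    obtain \<nu> where v: "\<nu> \<in> {1..n}" "a \<nu> \<noteq> a' \<nu>"
      using 3(2) PiE_ext[of a _ _ a'] assms(3,6) unfolding I2n_def by blast
    then have n1: "\<not> abs2 (a \<nu> - a' \<nu>) \<le> 1" using I2_unique assms(3,6) by (auto simp: I2n_def PiE_iff)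
    have "\<not> (t \<in> dball j (a \<nu>) \<and> t \<in> dball j (a' \<nu>))" for t
      using abs2_diff_trans[of "a \<nu>" "2 powi j * t" 1 "a' \<nu>"] n1 by (auto simp: dball_def abs2_minus_commute)
    then have "haar_wave (\<nu> \<in> e) j (a \<nu>) t * haar_wave (\<nu> \<in> e') j (a' \<nu>) t = 0" for t
      using haar_wave_outside by (metis mult_eq_0_iff)
    then have "(\<integral>t. haar_wave (\<nu> \<in> e) j (a \<nu>) t * haar_wave (\<nu> \<in> e') j (a' \<nu>) t \<partial>haar) = 0"
      by (simp only: integral_zero)
    then show ?thesis
      unfolding wave_prod_mult_integral(2) using v(1) 3(1) by (intro prod_zero bexI[of _ \<nu>]) auto
  next
    case 4
    then consider "\<not> e \<subseteq> e'" | "\<not> e' \<subseteq> e" by blast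
    then show ?thesis
    proof cases
      case 1
      then show ?thesis using 4 assms wave_prod_orthogonal_aux by blast
    next
      case 2
      then show ?thesis unfolding sym using 4 assms wave_prod_orthogonal_aux by blast
    qed
  qed
qed

lemma Psi_L2:
  assumes "n \<ge> 1"
  shows "Psi n e j a \<in> L2_space (Q2n n)"
proof -
  define c where "c = (2::real) powr (- (real n * real_of_int j / 2))"
  have eq: "Psi n e j a = (\<lambda>x. of_real (c * wave_prod n e j a x))"
    unfolding c_def by (rule ext) (rule Psi_eq_wave_prod[OF assms])
  have "(cmod (Psi n e j a x))\<^sup>2 = c\<^sup>2 * (wave_prod n e j a x * wave_prod n e j a x)" for x
    unfolding eq by (simp only: norm_of_real power2_abs power_mult_distrib) (simp add: power2_eq_square)
  then show ?thesis unfolding L2_space_def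
    using wave_prod_mult_integral(1)[of n e j a e j a] by (simp add: eq)
qed

lemma Psi_orthonormal:
  assumes "n \<ge> 1" "e \<subseteq> {1..n}" "e \<noteq> {}" "a \<in> I2n n" "e' \<subseteq> {1..n}" "e' \<noteq> {}" "a' \<in> I2n n"
  shows "L2_inner (Q2n n) (Psi n e j a) (Psi n e' j' a') = (if (e, j, a) = (e', j', a') then 1 else 0)"
proof -
  define c where "c j = (2::real) powr (- (real n * real_of_int j / 2))" for j
  have "L2_inner (Q2n n) (Psi n e j a) (Psi n e' j' a') =
    (\<integral>x. complex_of_real (c j * c j' * (wave_prod n e j a x * wave_prod n e' j' a' x)) \<partial>Q2n n)"
    unfolding L2_inner_def c_def Psi_eq_wave_prod[OF assms(1)] by (simp add: algebra_simps)
  also have "\<dots> = of_real (c j * c j' * (\<integral>x. wave_prod n e j a x * wave_prod n e' j' a' x \<partial>Q2n n))"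
    by (simp only: integral_complex_of_real integral_mult_right_zero)
  also have "\<dots> = (if (e, j, a) = (e', j', a') then 1 else 0)"
  proof (cases "(e, j, a) = (e', j', a')")
    case False
    then show ?thesis using wave_prod_orthogonal[OF assms(2-)] by simp
  next
    case True
    \<comment> \<open>The squared normalizing factor cancels the measure 2 to the power
      \<open>n j\<close> of the supporting cube.\<close>
    have "(2 powi j) ^ n = (2::real) powr (real n * real_of_int j)"
      by (simp add: powr_powr mult.commute flip: powr_realpow powr_real_of_int')
    then have "c j * c j * (2 powi j) ^ n = 1"
      by (simp add: c_def flip: powr_add)
    then show ?thesis using True wave_prod_norm[of n e j a] by (simp add: power2_eq_square)
  qed
  finally show ?thesis .
qed

subsection \<open>Closed spans in \<open>\<L>\<^sup>2\<close>\<close>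

lemma L2_norm_nonneg: "L2_norm M f \<ge> 0"
  by (simp add: L2_norm_def)

lemma L2_space_cmult:
  assumes "f \<in> L2_space M"
  shows "(\<lambda>x. c * f x) \<in> L2_space M"
  using assms by (auto simp: L2_space_def norm_mult power_mult_distrib)

lemma L2_norm_cmult: "L2_norm M (\<lambda>x. c * f x) = cmod c * L2_norm M f"
  by (simp add: L2_norm_def norm_mult power_mult_distrib real_sqrt_mult)

lemma cmod_add_squared_le: "(cmod (a + b))\<^sup>2 \<le> 2 * (cmod a)\<^sup>2 + 2 * (cmod b)\<^sup>2"
proof -
  have "(cmod (a + b))\<^sup>2 \<le> (cmod a + cmod b)\<^sup>2" by (intro power_mono norm_triangle_ineq) simp
  also have "\<dots> \<le> 2 * (cmod a)\<^sup>2 + 2 * (cmod b)\<^sup>2"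
    using zero_le_power2[of "cmod a - cmod b"] by (simp add: power2_eq_square algebra_simps)
  finally show ?thesis .
qed

lemma L2_space_add:
  assumes "f \<in> L2_space M" "g \<in> L2_space M"
  shows "(\<lambda>x. f x + g x) \<in> L2_space M"
proof -
  have m: "f \<in> borel_measurable M" "g \<in> borel_measurable M" using assms by (simp_all add: L2_space_def)
  have "integrable M (\<lambda>x. 2 * (cmod (f x))\<^sup>2 + 2 * (cmod (g x))\<^sup>2)"
    using assms by (simp add: L2_space_def)
  then have "integrable M (\<lambda>x. (cmod (f x + g x))\<^sup>2)"
    by (rule Bochner_Integration.integrable_bound) (use m in \<open>simp_all add: cmod_add_squared_le\<close>)
  with m show ?thesis by (simp add: L2_space_def)
qed

text \<open>The constant 2 spares us Minkowski's inequality; any constant is good enough for closure arguments.\<close>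

lemma L2_norm_add_le:
  assumes "f \<in> L2_space M" "g \<in> L2_space M"
  shows "L2_norm M (\<lambda>x. f x + g x) \<le> 2 * (L2_norm M f + L2_norm M g)"
proof -
  have int: "integrable M (\<lambda>x. (cmod (f x))\<^sup>2)" "integrable M (\<lambda>x. (cmod (g x))\<^sup>2)"
    "integrable M (\<lambda>x. (cmod (f x + g x))\<^sup>2)"
    using assms L2_space_add[OF assms] by (simp_all add: L2_space_def)
  have sq: "(L2_norm M h)\<^sup>2 = (\<integral>x. (cmod (h x))\<^sup>2 \<partial>M)" for h
    by (simp add: L2_norm_def)
  have "(L2_norm M (\<lambda>x. f x + g x))\<^sup>2 \<le> (\<integral>x. 2 * (cmod (f x))\<^sup>2 + 2 * (cmod (g x))\<^sup>2 \<partial>M)"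
    unfolding sq using int by (intro integral_mono) (simp_all add: cmod_add_squared_le)
  also have "\<dots> = 2 * (L2_norm M f)\<^sup>2 + 2 * (L2_norm M g)\<^sup>2"
    using int by (simp add: sq)
  also have "\<dots> \<le> (2 * (L2_norm M f + L2_norm M g))\<^sup>2"
    using mult_nonneg_nonneg[OF L2_norm_nonneg[of M f] L2_norm_nonneg[of M g]]
    by (simp add: power2_eq_square algebra_simps)
  finally show ?thesis by (rule power2_le_imp_le) (simp add: L2_norm_nonneg)
qed

lemma L2_space_diff:
  "f \<in> L2_space M \<Longrightarrow> g \<in> L2_space M \<Longrightarrow> (\<lambda>x. f x - g x) \<in> L2_space M"
  using L2_space_add[OF _ L2_space_cmult[of g M "- 1"], of f] by simp

lemma L2_space_zero: "(\<lambda>x. 0) \<in> L2_space M"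
  by (simp add: L2_space_def)

lemma L2_space_sum:
  "finite F \<Longrightarrow> (\<And>i. i \<in> F \<Longrightarrow> f i \<in> L2_space M) \<Longrightarrow> (\<lambda>x. \<Sum>i\<in>F. f i x) \<in> L2_space M"
  by (induction F rule: finite_induct) (simp_all add: L2_space_add L2_space_zero)

text \<open>The density clause of \<open>orthonormal_basis_L2\<close>, turned into a set of
  functions whose closure properties can be proved one by one.\<close>

definition L2_span_closure :: "'a measure \<Rightarrow> 'i set \<Rightarrow> ('i \<Rightarrow> 'a \<Rightarrow> complex) \<Rightarrow> ('a \<Rightarrow> complex) set" where
  "L2_span_closure M I \<phi> = {f \<in> L2_space M. \<forall>\<epsilon>>0. \<exists>F c. finite F \<and> F \<subseteq> I \<and>
        L2_norm M (\<lambda>x. f x - (\<Sum>i\<in>F. c i * \<phi> i x)) < \<epsilon>}"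

context
  fixes M :: "'a measure" and I :: "'i set" and \<phi> :: "'i \<Rightarrow> 'a \<Rightarrow> complex"
  assumes \<phi>: "\<And>i. i \<in> I \<Longrightarrow> \<phi> i \<in> L2_space M"
begin

lemma L2_space_lincomb: "finite F \<Longrightarrow> F \<subseteq> I \<Longrightarrow> (\<lambda>x. \<Sum>i\<in>F. c i * \<phi> i x) \<in> L2_space M"
  using \<phi> by (intro L2_space_sum L2_space_cmult) auto

lemma L2_span_closure_base: "i \<in> I \<Longrightarrow> \<phi> i \<in> L2_span_closure M I \<phi>"
  unfolding L2_span_closure_def using \<phi>
  by (auto intro!: exI[of _ "{i}"] exI[of _ "\<lambda>_. 1"] simp: L2_norm_def)

lemma L2_span_closure_zero: "(\<lambda>x. 0) \<in> L2_span_closure M I \<phi>"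
  unfolding L2_span_closure_def
  by (auto intro!: exI[of _ "{}"] simp: L2_norm_def L2_space_zero)

text \<open>Agreement on \<open>space M\<close> is the right condition because points of
  \<open>Q2n n\<close> are extensional functions: indicators of cubes and tensor products coincide
  only there.\<close>

lemma L2_span_closure_cong:
  assumes "f \<in> L2_span_closure M I \<phi>" "\<And>x. x \<in> space M \<Longrightarrow> f x = g x"
  shows "g \<in> L2_span_closure M I \<phi>"
proof -
  have "g \<in> borel_measurable M \<longleftrightarrow> f \<in> borel_measurable M"
    by (rule measurable_cong) (simp add: assms(2))
  moreover have "integrable M (\<lambda>x. (cmod (g x))\<^sup>2) \<longleftrightarrow> integrable M (\<lambda>x. (cmod (f x))\<^sup>2)"
    by (rule Bochner_Integration.integrable_cong) (simp_all add: assms(2))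
  moreover have "L2_norm M (\<lambda>x. g x - h x) = L2_norm M (\<lambda>x. f x - h x)" for h
    unfolding L2_norm_def
    by (intro arg_cong[of _ _ sqrt] Bochner_Integration.integral_cong) (simp_all add: assms(2))
  ultimately show ?thesis using assms(1) by (simp add: L2_span_closure_def L2_space_def)
qed

lemma L2_span_closure_cmult:
  assumes "f \<in> L2_span_closure M I \<phi>"
  shows "(\<lambda>x. a * f x) \<in> L2_span_closure M I \<phi>"
  unfolding L2_span_closure_def
proof (safe)
  show "(\<lambda>x. a * f x) \<in> L2_space M" using assms by (simp add: L2_span_closure_def L2_space_cmult)
  fix e :: real assume e: "e > 0"
  \<comment> \<open>Adding 1 avoids a division by zero when \<open>a = 0\<close>.\<close>
  have pos: "cmod a + 1 > 0" using norm_ge_zero[of a] by linarith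
  then have "e / (cmod a + 1) > 0" using e by simp
  then obtain F c where F: "finite F" "F \<subseteq> I" "L2_norm M (\<lambda>x. f x - (\<Sum>i\<in>F. c i * \<phi> i x)) < e / (cmod a + 1)"
    using assms unfolding L2_span_closure_def by blast
  have "(\<lambda>x. a * f x - (\<Sum>i\<in>F. a * c i * \<phi> i x)) = (\<lambda>x. a * (f x - (\<Sum>i\<in>F. c i * \<phi> i x)))"
    by (simp add: right_diff_distrib sum_distrib_left mult.assoc)
  then have "L2_norm M (\<lambda>x. a * f x - (\<Sum>i\<in>F. a * c i * \<phi> i x)) = cmod a * L2_norm M (\<lambda>x. f x - (\<Sum>i\<in>F. c i * \<phi> i x))"
    by (simp only: L2_norm_cmult)
  also have "\<dots> \<le> cmod a * (e / (cmod a + 1))" using F(3) by (intro mult_left_mono) auto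
  also have "\<dots> < e" using e pos by (simp add: field_simps)
  finally show "\<exists>F c. finite F \<and> F \<subseteq> I \<and> L2_norm M (\<lambda>x. a * f x - (\<Sum>i\<in>F. c i * \<phi> i x)) < e"
    using F(1,2) by (intro exI[of _ F] exI[of _ "\<lambda>i. a * c i"]) auto
qed

lemma L2_span_closure_add:
  assumes "f \<in> L2_span_closure M I \<phi>" "g \<in> L2_span_closure M I \<phi>"
  shows "(\<lambda>x. f x + g x) \<in> L2_span_closure M I \<phi>"
  unfolding L2_span_closure_def
proof (safe)
  have L2: "f \<in> L2_space M" "g \<in> L2_space M" using assms by (simp_all add: L2_span_closure_def)
  then show "(\<lambda>x. f x + g x) \<in> L2_space M" by (rule L2_space_add)
  fix e :: real assume "e > 0"
  \<comment> \<open>The tolerance \<open>e / 4\<close> compensates for the constant 2 in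
    \<open>L2_norm_add_le\<close>.\<close>
  then have e: "e / 4 > 0" by simp
  obtain F c where F: "finite F" "F \<subseteq> I" "L2_norm M (\<lambda>x. f x - (\<Sum>i\<in>F. c i * \<phi> i x)) < e / 4"
    using assms(1) e unfolding L2_span_closure_def by blast
  obtain G d where G: "finite G" "G \<subseteq> I" "L2_norm M (\<lambda>x. g x - (\<Sum>i\<in>G. d i * \<phi> i x)) < e / 4"
    using assms(2) e unfolding L2_span_closure_def by blast
  \<comment> \<open>The index sets may overlap, so both coefficient families are extended by 0 and
    added on the union.\<close>
  define b where "b i = (if i \<in> F then c i else 0) + (if i \<in> G then d i else 0)" for i
  have "(\<Sum>i\<in>F \<union> G. b i * \<phi> i x) = (\<Sum>i\<in>F. c i * \<phi> i x) + (\<Sum>i\<in>G. d i * \<phi> i x)" for x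
  proof -
    have "(\<Sum>i\<in>F \<union> G. (if i \<in> F then c i else 0) * \<phi> i x) = (\<Sum>i\<in>F. c i * \<phi> i x)"
      using F(1) G(1) by (intro sum.mono_neutral_cong_right) auto
    moreover have "(\<Sum>i\<in>F \<union> G. (if i \<in> G then d i else 0) * \<phi> i x) = (\<Sum>i\<in>G. d i * \<phi> i x)"
      using F(1) G(1) by (intro sum.mono_neutral_cong_right) auto
    ultimately show ?thesis by (simp only: b_def distrib_right sum.distrib)
  qed
  then have "L2_norm M (\<lambda>x. f x + g x - (\<Sum>i\<in>F \<union> G. b i * \<phi> i x)) =
    L2_norm M (\<lambda>x. (f x - (\<Sum>i\<in>F. c i * \<phi> i x)) + (g x - (\<Sum>i\<in>G. d i * \<phi> i x)))"
    by (simp add: algebra_simps)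
  also have "\<dots> \<le> 2 * (L2_norm M (\<lambda>x. f x - (\<Sum>i\<in>F. c i * \<phi> i x)) + L2_norm M (\<lambda>x. g x - (\<Sum>i\<in>G. d i * \<phi> i x)))"
    using F G L2 by (intro L2_norm_add_le L2_space_diff L2_space_lincomb)
  also have "\<dots> < e" using F(3) G(3) by simp
  finally show "\<exists>F c. finite F \<and> F \<subseteq> I \<and> L2_norm M (\<lambda>x. f x + g x - (\<Sum>i\<in>F. c i * \<phi> i x)) < e"
    using F(1,2) G(1,2) by (intro exI[of _ "F \<union> G"] exI[of _ b]) auto
qed

lemma L2_span_closure_diff:
  "f \<in> L2_span_closure M I \<phi> \<Longrightarrow> g \<in> L2_span_closure M I \<phi> \<Longrightarrow> (\<lambda>x. f x - g x) \<in> L2_span_closure M I \<phi>"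
  using L2_span_closure_add[OF _ L2_span_closure_cmult[of g "- 1"], of f] by simp

lemma L2_span_closure_sum:
  "finite F \<Longrightarrow> (\<And>i. i \<in> F \<Longrightarrow> f i \<in> L2_span_closure M I \<phi>) \<Longrightarrow>
    (\<lambda>x. \<Sum>i\<in>F. f i x) \<in> L2_span_closure M I \<phi>"
  by (induction F rule: finite_induct) (simp_all add: L2_span_closure_add L2_span_closure_zero)

lemma L2_span_closure_limit:
  assumes f: "f \<in> L2_space M" and g: "\<And>k::nat. g k \<in> L2_span_closure M I \<phi>"
    and lim: "(\<lambda>k. \<integral>x. (cmod (f x - g k x))\<^sup>2 \<partial>M) \<longlonglongrightarrow> 0"
  shows "f \<in> L2_span_closure M I \<phi>"
  unfolding L2_span_closure_def
proof (safe)
  show "f \<in> L2_space M" by fact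
  fix e :: real assume "e > 0"
  then have e: "e / 4 > 0" by simp
  have "(\<lambda>k. L2_norm M (\<lambda>x. f x - g k x)) \<longlonglongrightarrow> 0"
    using tendsto_real_sqrt[OF lim] by (simp add: L2_norm_def)
  then have "eventually (\<lambda>k. L2_norm M (\<lambda>x. f x - g k x) < e / 4) sequentially"
    using e by (rule order_tendstoD(2))
  then obtain k where k: "L2_norm M (\<lambda>x. f x - g k x) < e / 4"
    by (auto simp: eventually_sequentially)
  obtain F c where F: "finite F" "F \<subseteq> I" "L2_norm M (\<lambda>x. g k x - (\<Sum>i\<in>F. c i * \<phi> i x)) < e / 4"
    using g[of k] e unfolding L2_span_closure_def by blast
  have gk: "g k \<in> L2_space M" using g by (simp add: L2_span_closure_def)
  have "L2_norm M (\<lambda>x. f x - (\<Sum>i\<in>F. c i * \<phi> i x)) =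
    L2_norm M (\<lambda>x. (f x - g k x) + (g k x - (\<Sum>i\<in>F. c i * \<phi> i x)))"
    by simp
  also have "\<dots> \<le> 2 * (L2_norm M (\<lambda>x. f x - g k x) + L2_norm M (\<lambda>x. g k x - (\<Sum>i\<in>F. c i * \<phi> i x)))"
    using F f gk by (intro L2_norm_add_le L2_space_diff L2_space_lincomb)
  also have "\<dots> < e" using F(3) k by simp
  finally show "\<exists>F c. finite F \<and> F \<subseteq> I \<and> L2_norm M (\<lambda>x. f x - (\<Sum>i\<in>F. c i * \<phi> i x)) < e"
    using F(1,2) by blast
qed

text \<open>An integrable bound on the squared error upgrades pointwise convergence to convergence
  in the L2 norm.\<close>

lemma L2_span_closure_dominated:
  assumes f: "f \<in> L2_space M" and g: "\<And>k::nat. g k \<in> L2_span_closure M I \<phi>"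
    and lim: "\<And>x. x \<in> space M \<Longrightarrow> (\<lambda>k. g k x) \<longlonglongrightarrow> f x"
    and w: "integrable M w" "\<And>k x. x \<in> space M \<Longrightarrow> (cmod (f x - g k x))\<^sup>2 \<le> w x"
  shows "f \<in> L2_span_closure M I \<phi>"
proof (rule L2_span_closure_limit[OF f g])
  have [measurable]: "f \<in> borel_measurable M" "g k \<in> borel_measurable M" for k
    using f g[of k] by (simp_all add: L2_span_closure_def L2_space_def)
  have "(\<lambda>k. \<integral>x. (cmod (f x - g k x))\<^sup>2 \<partial>M) \<longlonglongrightarrow> (\<integral>x. 0 \<partial>M)"
  proof (rule integral_dominated_convergence[where w = w])
    show "AE x in M. (\<lambda>k. (cmod (f x - g k x))\<^sup>2) \<longlonglongrightarrow> 0"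
    proof (rule AE_I2)
      fix x assume "x \<in> space M"
      have "(\<lambda>k. (cmod (f x - g k x))\<^sup>2) \<longlonglongrightarrow> (cmod (f x - f x))\<^sup>2"
        by (intro tendsto_intros lim \<open>x \<in> space M\<close>)
      then show "(\<lambda>k. (cmod (f x - g k x))\<^sup>2) \<longlonglongrightarrow> 0" by simp
    qed
  qed (use w in auto)
  then show "(\<lambda>k. \<integral>x. (cmod (f x - g k x))\<^sup>2 \<partial>M) \<longlonglongrightarrow> 0" by simp
qed

end

subsection \<open>Density\<close>

definition Psi_index :: "nat \<Rightarrow> (nat set \<times> int \<times> (nat \<Rightarrow> Q2)) set" where
  "Psi_index n = {(e, j, a). e \<subseteq> {1..n} \<and> e \<noteq> {} \<and> a \<in> I2n n}"

abbreviation Psi_closure :: "nat \<Rightarrow> ((nat \<Rightarrow> Q2) \<Rightarrow> complex) set" where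
  "Psi_closure n \<equiv> L2_span_closure (Q2n n) (Psi_index n) (\<lambda>(e, j, a). Psi n e j a)"

lemma Psi_index_L2: "n \<ge> 1 \<Longrightarrow> i \<in> Psi_index n \<Longrightarrow> (\<lambda>(e, j, a). Psi n e j a) i \<in> L2_space (Q2n n)"
  by (cases i) (simp add: Psi_L2)

text \<open>The family contains only translations in \<open>I2n n\<close>. Replacing each coordinate
  of \<open>a\<close> by its representative costs a scalar per coordinate, by
  \<open>haar_wave_shift\<close>.\<close>

lemma wave_prod_in_closure:
  assumes n: "n \<ge> 1" and e: "e \<subseteq> {1..n}" "e \<noteq> {}"
  shows "(\<lambda>x. of_real (wave_prod n e j a x)) \<in> Psi_closure n"
proof -
  obtain a' where a': "a' \<in> I2n n" "\<And>\<nu>. \<nu> \<in> {1..n} \<Longrightarrow> abs2 (a \<nu> - a' \<nu>) \<le> 1"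
    using I2n_approx[of n a] by blast
  then have "\<forall>\<nu>\<in>{1..n}. \<exists>s. \<forall>x. haar_wave (\<nu> \<in> e) j (a \<nu>) x = s * haar_wave (\<nu> \<in> e) j (a' \<nu>) x"
    using haar_wave_shift by blast
  then obtain s where s: "\<And>\<nu> x. \<nu> \<in> {1..n} \<Longrightarrow>
      haar_wave (\<nu> \<in> e) j (a \<nu>) x = s \<nu> * haar_wave (\<nu> \<in> e) j (a' \<nu>) x"
    by metis
  define d where "d = (2::real) powr (- (real n * real_of_int j / 2))"
  have "wave_prod n e j a x = prod s {1..n} * wave_prod n e j a' x" for x
    unfolding wave_prod_def prod.distrib[symmetric] by (intro prod.cong refl s)
  then have "complex_of_real (wave_prod n e j a x) = of_real (prod s {1..n} / d) * Psi n e j a' x" for x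
    by (simp only: Psi_eq_wave_prod[OF n]) (simp add: d_def)
  moreover have "Psi n e j a' \<in> Psi_closure n"
    using L2_span_closure_base[of "Psi_index n" "\<lambda>(e, j, a). Psi n e j a" "Q2n n" "(e, j, a')"]
      Psi_index_L2[OF n] e a'(1) by (simp add: Psi_index_def)
  ultimately show ?thesis
    by (simp only:) (intro L2_span_closure_cmult Psi_index_L2[OF n])
qed

text \<open>\<open>dball j b\<close> is the half of its parent ball on which the parent wavelet is
  +1; on the other half wavelet and indicator cancel.\<close>

lemma indicator_dball_average:
  "indicator (dball j b) t = 1/2 * (haar_wave True (j + 1) (2 * b) t + haar_wave False (j + 1) (2 * b) t)"
  using dball_split[of j b] by (auto simp: haar_wave_def indicator_def)

text \<open>Expanding the product of the coordinatewise averages, \<open>e\<close> is the set of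
  coordinates from which the wavelet is chosen.\<close>

lemma wave_prod_refine:
  "wave_prod n {} j b x = (1/2) ^ n * (\<Sum>e\<in>Pow {1..n}. wave_prod n e (j + 1) (\<lambda>\<nu>. 2 * b \<nu>) x)"
proof -
  let ?h = "\<lambda>c \<nu>. haar_wave c (j + 1) (2 * b \<nu>) (x \<nu>)"
  have "wave_prod n {} j b x = (\<Prod>\<nu>=1..n. 1/2 * (?h True \<nu> + ?h False \<nu>))"
    unfolding wave_prod_def indicator_dball_average[symmetric] by (simp add: haar_wave_def)
  also have "\<dots> = (1/2) ^ n * (\<Prod>\<nu>=1..n. ?h True \<nu> + ?h False \<nu>)"
    unfolding prod.distrib by simp
  also have "(\<Prod>\<nu>=1..n. ?h True \<nu> + ?h False \<nu>) =
      (\<Sum>e\<in>Pow {1..n}. prod (?h True) e * prod (?h False) ({1..n} - e))"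
    by (rule prod_add) simp
  also have "\<dots> = (\<Sum>e\<in>Pow {1..n}. wave_prod n e (j + 1) (\<lambda>\<nu>. 2 * b \<nu>) x)"
  proof (rule sum.cong)
    fix e assume "e \<in> Pow {1..n}"
    then have e: "e \<subseteq> {1..n}" by simp
    have "wave_prod n e (j + 1) (\<lambda>\<nu>. 2 * b \<nu>) x =
        (\<Prod>\<nu>\<in>{1..n} - e. ?h (\<nu> \<in> e) \<nu>) * (\<Prod>\<nu>\<in>e. ?h (\<nu> \<in> e) \<nu>)"
      unfolding wave_prod_def by (rule prod.subset_diff[OF e]) simp
    also have "\<dots> = prod (?h False) ({1..n} - e) * prod (?h True) e"
      by (intro arg_cong2[where f = "(*)"] prod.cong) auto
    finally show "prod (?h True) e * prod (?h False) ({1..n} - e) = wave_prod n e (j + 1) (\<lambda>\<nu>. 2 * b \<nu>) x"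
      by (simp only: mult.commute)
  qed simp
  finally show ?thesis .
qed

text \<open>Iteration of \<open>wave_prod_refine\<close>: at each step the terms with nonempty
  \<open>e\<close> already lie in the closure, and the term with \<open>e = {}\<close> is refined
  again one scale up.\<close>

lemma wave_prod_coarsen:
  assumes n: "n \<ge> 1"
  shows "(\<lambda>x. of_real (wave_prod n {} j b x - (1/2) ^ (n * k) * wave_prod n {} (j + int k) (\<lambda>\<nu>. 2 ^ k * b \<nu>) x))
    \<in> Psi_closure n"
proof (induction k)
  case 0
  show ?case using L2_span_closure_zero[of "Psi_index n", OF Psi_index_L2[OF n]] by simp
next
  case (Suc k)
  note base = Psi_index_L2[OF n]
  let ?w = "\<lambda>e. wave_prod n e (j + int (Suc k)) (\<lambda>\<nu>. 2 ^ Suc k * b \<nu>)"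
  have shift: "j + int (Suc k) = j + int k + 1" "(\<lambda>\<nu>. 2 ^ Suc k * b \<nu>) = (\<lambda>\<nu>. 2 * (2 ^ k * b \<nu>))"
    by (simp_all add: mult.assoc)
  have sum: "wave_prod n {} (j + int k) (\<lambda>\<nu>. 2 ^ k * b \<nu>) x =
      (1/2) ^ n * (?w {} x + (\<Sum>e\<in>Pow {1..n} - {{}}. ?w e x))" for x
    unfolding wave_prod_refine[of n "j + int k"] shift
    by (subst sum.remove[of _ "{}"]) simp_all
  have "wave_prod n {} j b x - (1/2) ^ (n * Suc k) * ?w {} x =
      (wave_prod n {} j b x - (1/2) ^ (n * k) * wave_prod n {} (j + int k) (\<lambda>\<nu>. 2 ^ k * b \<nu>) x)
      + (1/2) ^ (n * Suc k) * (\<Sum>e\<in>Pow {1..n} - {{}}. ?w e x)" for x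
    unfolding sum by (simp add: power_add algebra_simps)
  then have eq: "complex_of_real (wave_prod n {} j b x - (1/2) ^ (n * Suc k) * ?w {} x) =
      of_real (wave_prod n {} j b x - (1/2) ^ (n * k) * wave_prod n {} (j + int k) (\<lambda>\<nu>. 2 ^ k * b \<nu>) x)
      + (1/2) ^ (n * Suc k) * (\<Sum>e\<in>Pow {1..n} - {{}}. of_real (?w e x))" for x
    by (simp only:) simp
  show ?case unfolding eq
    by (intro L2_span_closure_add[OF base] L2_span_closure_cmult[OF base] L2_span_closure_sum[OF base]
        Suc.IH wave_prod_in_closure[OF n]) auto
qed

lemma wave_prod_L2: "(\<lambda>x. of_real (wave_prod n e j a x)) \<in> L2_space (Q2n n)"
  using wave_prod_mult_integral(1)[of n e j a e j a] by (simp add: L2_space_def power2_eq_square)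

text \<open>The remainder after \<open>k\<close> steps keeps its integral, but spreads over a cube
  of measure 2 to the power \<open>n (j + k)\<close> with height 2 to the power
  \<open>- n k\<close>. Its squared norm is therefore 2 to the power \<open>n j - n k\<close>, which
  tends to 0 as \<open>n \<ge> 1\<close>.\<close>

lemma wave_prod_empty_in_closure:
  assumes n: "n \<ge> 1"
  shows "(\<lambda>x. of_real (wave_prod n {} j b x)) \<in> Psi_closure n"
proof (rule L2_span_closure_limit[OF Psi_index_L2[OF n] wave_prod_L2 wave_prod_coarsen[OF n]])
  let ?g = "\<lambda>k x. (1/2) ^ (n * k) * wave_prod n {} (j + int k) (\<lambda>\<nu>. 2 ^ k * b \<nu>) x"
  have "(\<integral>x. (cmod (of_real (wave_prod n {} j b x) - of_real (wave_prod n {} j b x - ?g k x)))\<^sup>2 \<partial>Q2n n)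
      = ((1/2) ^ n) ^ k * (2 powi j) ^ n" for k
  proof -
    have "(cmod (of_real (wave_prod n {} j b x) - of_real (wave_prod n {} j b x - ?g k x)))\<^sup>2 = (?g k x)\<^sup>2" for x
      by (simp flip: of_real_diff add: norm_mult power_mult_distrib norm_power)
    then have "(\<integral>x. (cmod (of_real (wave_prod n {} j b x) - of_real (wave_prod n {} j b x - ?g k x)))\<^sup>2 \<partial>Q2n n)
      = ((1/2) ^ (n * k))\<^sup>2 * (2 powi (j + int k)) ^ n"
      by (simp add: power_mult_distrib wave_prod_norm)
    also have "\<dots> = ((1/2) ^ n) ^ k * (2 powi j) ^ n"
      by (simp add: power_int_add power_mult_distrib power2_eq_square field_simps flip: power_mult)
    finally show ?thesis .
  qed
  moreover have "(\<lambda>k. ((1/2::real) ^ n) ^ k * (2 powi j) ^ n) \<longlonglongrightarrow> 0"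
    using n by (intro tendsto_mult_left_zero LIMSEQ_power_zero) (simp add: power_less_one_iff)
  ultimately show "(\<lambda>k. \<integral>x. (cmod (of_real (wave_prod n {} j b x) - of_real (wave_prod n {} j b x - ?g k x)))\<^sup>2 \<partial>Q2n n)
      \<longlonglongrightarrow> 0"
    by simp
qed

section \<open>Cubes generate the measurable sets\<close>

definition cube :: "nat \<Rightarrow> int \<Rightarrow> (nat \<Rightarrow> Q2) \<Rightarrow> (nat \<Rightarrow> Q2) set" where
  "cube n j a = {x \<in> space (Q2n n). \<forall>\<nu>\<in>{1..n}. x \<nu> \<in> dball j (a \<nu>)}"

lemma cube_subset: "cube n j a \<subseteq> space (Q2n n)"
  by (auto simp: cube_def)

lemma cube_measurable [measurable]: "cube n j a \<in> sets (Q2n n)"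
  unfolding cube_def Q2n_def by measurable

lemma wave_prod_empty: "x \<in> space (Q2n n) \<Longrightarrow> wave_prod n {} j a x = indicator (cube n j a) x"
  by (auto simp: wave_prod_def haar_wave_def cube_def indicator_def)

lemma integrable_cube: "integrable (Q2n n) (indicator (cube n j a) :: _ \<Rightarrow> real)"
proof (rule iffD1[OF Bochner_Integration.integrable_cong wave_prod_mult_integral(1)])
  fix x assume "x \<in> space (Q2n n)"
  then show "wave_prod n {} j a x * wave_prod n {} j a x = indicator (cube n j a) x"
    by (simp add: wave_prod_empty indicator_def)
qed simp

text \<open>A common point makes the balls nested in every coordinate, and always in the same
  direction because each cube has a single scale.\<close>

lemma cube_Int:
  assumes "j \<le> i"
  shows "cube n j a \<inter> cube n i b = {} \<or> cube n j a \<inter> cube n i b = cube n j a"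
  using dball_nested[OF assms] unfolding cube_def by blast

text \<open>The product sigma algebra is generated by the coordinate maps, so it suffices that
  preimages of balls under coordinates are countable unions of cubes.\<close>

lemma sets_Q2n: "sets (Q2n n) = sigma_sets (space (Q2n n)) (insert {} {cube n j a | j a. True})"
    (is "_ = sigma_sets ?S ?C")
proof
  have C: "?C \<subseteq> Pow ?S" using cube_subset by blast
  interpret sigma_algebra ?S "sigma_sets ?S ?C" using C by (rule sigma_algebra_sigma_sets)
  show "sigma_sets ?S ?C \<subseteq> sets (Q2n n)"
    by (rule sets.sigma_sets_subset) auto
  have m: "(\<lambda>x. x \<nu>) \<in> measurable (sigma ?S ?C) borel" if v: "\<nu> \<in> {1..n}" for \<nu>
  proof (rule borel_measurable_Q2I)
    fix c :: Q2 and k :: nat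
    let ?c = "c / 2 ^ k"
    have ball: "Q2_ball c k = dball (- int k) ?c" by (simp add: dball_eq_Q2_ball)
    \<comment> \<open>Coordinate \<open>\<nu>\<close> is confined to the class of \<open>?c\<close>,
      while the others run through all representatives, so cubes of one size fill the
      cylinder.\<close>
    have eq: "(\<lambda>x. x \<nu>) -` Q2_ball c k \<inter> ?S = (\<Union>a\<in>{a \<in> I2n n. abs2 (a \<nu> - ?c) \<le> 1}. cube n (- int k) a)"
    proof (intro equalityI subsetI)
      fix x assume "x \<in> (\<lambda>x. x \<nu>) -` Q2_ball c k \<inter> ?S"
      then have x: "abs2 (2 powi (- int k) * x \<nu> - ?c) \<le> 1" "x \<in> ?S"
        unfolding ball by (auto simp: dball_def)
      obtain a where a: "a \<in> I2n n" "\<And>\<nu>. \<nu> \<in> {1..n} \<Longrightarrow> abs2 (2 powi (- int k) * x \<nu> - a \<nu>) \<le> 1"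
        using I2n_approx[of n "\<lambda>\<nu>. 2 powi (- int k) * x \<nu>"] by blast
      have "abs2 (a \<nu> - 2 powi (- int k) * x \<nu>) \<le> 1" using a(2)[OF v] by (simp only: abs2_minus_commute)
      then have "abs2 (a \<nu> - ?c) \<le> 1" using x(1) by (rule abs2_diff_trans)
      moreover have "x \<in> cube n (- int k) a" using x(2) a(2) by (simp only: cube_def dball_def mem_Collect_eq) blast
      ultimately show "x \<in> (\<Union>a\<in>{a \<in> I2n n. abs2 (a \<nu> - ?c) \<le> 1}. cube n (- int k) a)" using a(1) by blast
    next
      fix x assume "x \<in> (\<Union>a\<in>{a \<in> I2n n. abs2 (a \<nu> - ?c) \<le> 1}. cube n (- int k) a)"
      then obtain a where a: "abs2 (a \<nu> - ?c) \<le> 1" "x \<in> cube n (- int k) a" by blast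
      then show "x \<in> (\<lambda>x. x \<nu>) -` Q2_ball c k \<inter> ?S"
        using v unfolding ball cube_def dball_cong[OF a(1), symmetric] by auto
    qed
    have "(\<Union>a\<in>{a \<in> I2n n. abs2 (a \<nu> - ?c) \<le> 1}. cube n (- int k) a) \<in> sigma_sets ?S ?C"
      by (intro countable_UN'' countable_Collect[OF countable_I2n]) (auto intro: sigma_sets.Basic)
    then show "(\<lambda>x. x \<nu>) -` Q2_ball c k \<inter> space (sigma ?S ?C) \<in> sets (sigma ?S ?C)"
      using C eq by (simp add: sets_measure_of space_measure_of)
  qed
  have coord: "(\<lambda>x. x \<nu>) -` A \<inter> ?S \<in> sigma_sets ?S ?C" if "\<nu> \<in> {1..n}" "A \<in> sets borel" for \<nu> A
    using measurable_sets[OF m[OF that(1)] that(2)] by (simp only: sets_measure_of[OF C] space_measure_of[OF C])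
  have "sets (Q2n n) = sigma_sets ?S {{x \<in> ?S. x \<nu> \<in> A} | \<nu> A. \<nu> \<in> {1..n} \<and> A \<in> sets borel}"
    unfolding Q2n_def by (simp add: sets_PiM_single space_PiM)
  also have "\<dots> \<subseteq> sigma_sets ?S ?C"
  proof (rule sigma_sets_subset, safe)
    fix \<nu> A assume "\<nu> \<in> {1..n}" "A \<in> sets (borel :: Q2 measure)"
    from coord[OF this] show "{x \<in> ?S. x \<nu> \<in> A} \<in> sigma_sets ?S ?C"
      by (simp only: vimage_def Int_def mem_Collect_eq conj_commute)
  qed
  finally show "sets (Q2n n) \<subseteq> sigma_sets ?S ?C" .
qed

section \<open>From cubes to arbitrary functions\<close>

text \<open>A Dynkin argument inside a fixed cube: without the intersection, complements could have
  infinite measure and leave L2.\<close>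

lemma indicator_in_closure:
  assumes n: "n \<ge> 1" and A: "A \<in> sets (Q2n n)"
  shows "indicator (A \<inter> cube n J b) \<in> Psi_closure n"
proof -
  note base = Psi_index_L2[OF n]
  let ?C = "insert {} {cube n j a | j a. True}"
  have cube: "indicator (cube n j a) \<in> Psi_closure n" for j a
    by (rule L2_span_closure_cong[OF base wave_prod_empty_in_closure[OF n, of j a]])
      (simp_all add: wave_prod_empty indicator_def)
  have empty: "indicator {} \<in> Psi_closure n"
    using L2_span_closure_zero[OF base] by (simp add: indicator_def[abs_def])
  have int: "X \<inter> Y \<in> ?C" if XY: "X \<in> ?C" "Y \<in> ?C" for X Y
  proof (cases "X = {} \<or> Y = {}")
    case False
    then obtain j a i c where "X = cube n j a" "Y = cube n i c" using XY by blast
    then show ?thesis using cube_Int[of j i n a c] cube_Int[of i j n c a] by (cases "j \<le> i") (auto simp: Int_commute)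
  qed auto
  have "Int_stable ?C" using int by (rule Int_stableI)
  moreover have "?C \<subseteq> Pow (space (Q2n n))" using cube_subset by blast
  moreover have "A \<in> sigma_sets (space (Q2n n)) ?C" using A sets_Q2n by blast
  ultimately show ?thesis
  proof (induction rule: sigma_sets_induct_disjoint)
    case (basic A)
    then have "A \<inter> cube n J b \<in> ?C" by (intro int) auto
    then consider "A \<inter> cube n J b = {}" | j a where "A \<inter> cube n J b = cube n j a" by blast
    then show ?case by cases (simp_all only: cube empty)
  next
    case empty
    show ?case using \<open>indicator {} \<in> Psi_closure n\<close> by (simp only: Int_empty_left)
  next
    \<comment> \<open>Within the cube, the indicator of the complement is that of the cube minus
      that of \<open>A\<close>.\<close>
    case (compl A)
    show ?case
      by (rule L2_span_closure_cong[OF base L2_span_closure_diff[OF base cube compl(2)]])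
        (auto simp: indicator_def)
  next
    case (union A)
    have sets: "A i \<in> sets (Q2n n)" for i using union(2) sets_Q2n by blast
    let ?B = "cube n J b"
    have disj: "disjoint_family_on (\<lambda>i. A i \<inter> ?B) {..<k}" for k
      using union(1) by (auto simp: disjoint_family_on_def)
    have "(\<lambda>x. \<Sum>i<k. indicator (A i \<inter> ?B) x) \<in> Psi_closure n" for k
      by (intro L2_span_closure_sum[OF base] union(3) finite_lessThan)
    then have part: "indicator (\<Union>i<k. A i \<inter> ?B) \<in> Psi_closure n" for k
      by (simp only: indicator_UN_disjoint[OF finite_lessThan disj, abs_def])
    \<comment> \<open>Finite partial unions converge pointwise, and the indicator of the fixed cube
      dominates the error.\<close>
    have "indicator (\<Union>i. A i \<inter> ?B) \<in> Psi_closure n"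
    proof (rule L2_span_closure_dominated[OF base _ part])
      have eq: "(cmod (indicator (\<Union>i. A i \<inter> ?B) x))\<^sup>2 = indicator (\<Union>i. A i \<inter> ?B) x" for x
        by (simp add: indicator_def)
      show "indicator (\<Union>i. A i \<inter> ?B) \<in> L2_space (Q2n n)"
        unfolding L2_space_def mem_Collect_eq eq
      proof
        show "integrable (Q2n n) (indicator (\<Union>i. A i \<inter> ?B) :: _ \<Rightarrow> real)"
          by (rule Bochner_Integration.integrable_bound[OF integrable_cube[of n J b]])
            (use sets in \<open>auto simp: indicator_def\<close>)
      qed (use sets in auto)
      show "(\<lambda>k. indicator (\<Union>i<k. A i \<inter> ?B) x :: complex) \<longlonglongrightarrow> indicator (\<Union>i. A i \<inter> ?B) x" for x
        by (rule LIMSEQ_indicator_UN)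
      show "integrable (Q2n n) (indicator ?B :: _ \<Rightarrow> real)" by (rule integrable_cube)
      show "(cmod (indicator (\<Union>i. A i \<inter> ?B) x - indicator (\<Union>i<k. A i \<inter> ?B) x))\<^sup>2 \<le> indicator ?B x" for k x
        by (auto simp: indicator_def)
    qed
    then show ?case by simp
  qed
qed

lemma eventually_in_cube: "eventually (\<lambda>i. x \<in> cube n (int i) (\<lambda>_. 0)) sequentially" if x: "x \<in> space (Q2n n)"
proof -
  have "eventually (\<lambda>i. x \<nu> \<in> dball (int i) 0) sequentially" for \<nu>
  proof -
    obtain N where N: "abs2 (x \<nu>) < 2 ^ N" using real_arch_pow[of 2 "abs2 (x \<nu>)"] by auto
    have "x \<nu> \<in> dball (int i) 0" if "i \<ge> N" for i
    proof -
      have "(2::real) ^ N \<le> 2 ^ i" using that by (intro power_increasing) auto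
      then have "abs2 (x \<nu>) \<le> 2 ^ i" using N by linarith
      then show ?thesis by (simp add: dball_def abs2_mult abs2_2_power power_one_over field_simps)
    qed
    then show ?thesis unfolding eventually_sequentially by blast
  qed
  then have "eventually (\<lambda>i. \<forall>\<nu>\<in>{1..n}. x \<nu> \<in> dball (int i) 0) sequentially"
    by (intro eventually_ball_finite) auto
  then show ?thesis using x by (simp add: cube_def)
qed

lemma L2_space_closure:
  assumes n: "n \<ge> 1" and f: "f \<in> L2_space (Q2n n)"
  shows "f \<in> Psi_closure n"
proof -
  note base = Psi_index_L2[OF n]
  have fm: "f \<in> borel_measurable (Q2n n)" and fi: "integrable (Q2n n) (\<lambda>x. (cmod (f x))\<^sup>2)"
    using f by (simp_all add: L2_space_def)
  obtain F where F: "\<And>i::nat. simple_function (Q2n n) (F i)"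
    "\<And>x. x \<in> space (Q2n n) \<Longrightarrow> (\<lambda>i. F i x) \<longlonglongrightarrow> f x"
    "\<And>i x. x \<in> space (Q2n n) \<Longrightarrow> dist (F i x) 0 \<le> 2 * dist (f x) 0"
    using borel_measurable_implies_sequence_metric[OF fm, of 0] by blast
  \<comment> \<open>Level sets of the simple functions, in particular that of 0, may have infinite
    measure. Cutting off by cubes that exhaust the space makes \<open>indicator_in_closure\<close>
    applicable.\<close>
  define B where "B i = cube n (int i) (\<lambda>_. 0)" for i
  show ?thesis
  proof (rule L2_span_closure_dominated[OF base f])
    show "(\<lambda>x. F i x * indicator (B i) x) \<in> Psi_closure n" for i
    proof (rule L2_span_closure_cong[OF base])
      let ?A = "\<lambda>y. F i -` {y} \<inter> space (Q2n n)"
      have fin: "finite (F i ` space (Q2n n))" using F(1) by (rule simple_functionD)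
      show "(\<lambda>x. \<Sum>y\<in>F i ` space (Q2n n). y * indicator (?A y \<inter> B i) x) \<in> Psi_closure n"
        unfolding B_def using fin F(1)[of i]
        by (intro L2_span_closure_sum[OF base] L2_span_closure_cmult[OF base] indicator_in_closure[OF n])
          (auto intro: simple_functionD)
      show "(\<Sum>y\<in>F i ` space (Q2n n). y * indicator (?A y \<inter> B i) x) = F i x * indicator (B i) x"
        if x: "x \<in> space (Q2n n)" for x
      proof -
        \<comment> \<open>Only the level set through \<open>x\<close> contributes.\<close>
        have "(\<Sum>y\<in>F i ` space (Q2n n). y * indicator (?A y \<inter> B i) x) =
            (\<Sum>y\<in>F i ` space (Q2n n). if y = F i x then F i x * indicator (B i) x else 0)"
          using x by (intro sum.cong) (auto simp: indicator_def)
        then show ?thesis using fin x by simp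
      qed
    qed
    show "(\<lambda>i. F i x * indicator (B i) x) \<longlonglongrightarrow> f x" if x: "x \<in> space (Q2n n)" for x
    proof -
      have "eventually (\<lambda>i. indicator (B i) x = (1::complex)) sequentially"
        using eventually_in_cube[OF x] by (rule eventually_mono) (simp add: B_def)
      then have "(\<lambda>i. indicator (B i) x :: complex) \<longlonglongrightarrow> 1" by (rule tendsto_eventually)
      from tendsto_mult[OF F(2)[OF x] this] show ?thesis by simp
    qed
    \<comment> \<open>The approximants satisfy |F i| \<le> 2 |f|, so the error is at most 3 |f|,
      whence the 9.\<close>
    show "integrable (Q2n n) (\<lambda>x. 9 * (cmod (f x))\<^sup>2)" using fi by simp
    show "(cmod (f x - F i x * indicator (B i) x))\<^sup>2 \<le> 9 * (cmod (f x))\<^sup>2" if x: "x \<in> space (Q2n n)" for i x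
    proof -
      have "cmod (f x - F i x * indicator (B i) x) \<le> cmod (f x) + cmod (F i x * indicator (B i) x)"
        by (rule norm_triangle_ineq4)
      also have "cmod (F i x * indicator (B i) x) \<le> 2 * cmod (f x)"
        using F(3)[OF x, of i] by (simp add: indicator_def)
      finally have "(cmod (f x - F i x * indicator (B i) x))\<^sup>2 \<le> (3 * cmod (f x))\<^sup>2"
        by (intro power_mono) auto
      then show ?thesis by (simp add: power_mult_distrib)
    qed
  qed
qed

theorem theorem5p2:
  fixes n :: nat
  assumes "n \<ge> 1"
  shows "orthonormal_basis_L2 (Q2n n)
    {(e, j, a). e \<subseteq> {1..n} \<and> e \<noteq> {} \<and> a \<in> I2n n}
    (\<lambda>(e, j, a). Psi n e j a)"
  unfolding orthonormal_basis_L2_def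
proof (intro conjI)
  show "\<forall>i\<in>{(e, j, a). e \<subseteq> {1..n} \<and> e \<noteq> {} \<and> a \<in> I2n n}. (\<lambda>(e, j, a). Psi n e j a) i \<in> L2_space (Q2n n)"
    using Psi_L2[OF assms] by auto
  show "\<forall>i\<in>{(e, j, a). e \<subseteq> {1..n} \<and> e \<noteq> {} \<and> a \<in> I2n n}.
       \<forall>k\<in>{(e, j, a). e \<subseteq> {1..n} \<and> e \<noteq> {} \<and> a \<in> I2n n}.
          L2_inner (Q2n n) ((\<lambda>(e, j, a). Psi n e j a) i) ((\<lambda>(e, j, a). Psi n e j a) k) = (if i = k then 1 else 0)"
    using Psi_orthonormal[OF assms] by auto
  show "\<forall>f\<in>L2_space (Q2n n). \<forall>\<epsilon>>0. \<exists>F c. finite F \<and>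
       F \<subseteq> {(e, j, a). e \<subseteq> {1..n} \<and> e \<noteq> {} \<and> a \<in> I2n n} \<and>
       L2_norm (Q2n n) (\<lambda>x. f x - (\<Sum>i\<in>F. c i * (\<lambda>(e, j, a). Psi n e j a) i x)) < \<epsilon>"
    using L2_space_closure[OF assms] unfolding L2_span_closure_def Psi_index_def by blast
qed

end
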